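(* Let the model, the state space $\Omega$, the constants, the functions $V_{i,j}, U_i, \kappa_{i,j}, g_1, g_2, f$, the function $H$ and the feedback laws $F_i(w),\delta_i(w)$ be as defined in the context. Then for every $w_0\in\Omega$ the initial-value problem consisting, for $i=1,\dots,n$, of $$\dot r_i=-v_i\sin(s_i),\quad \dot\varphi_i=\frac{v_i}{r_i}\cos(s_i),\quad \dot s_i=\frac{v_i}{\sigma_i}\tan(\delta_i)-\frac{v_i}{r_i}\cos(s_i),\quad \dot v_i=F_i,$$ with $F_i=F_i(w)$, $\delta_i=\delta_i(w)$ and $w(0)=w_0$, has a unique solution $w(t)$, defined for all $t\ge 0$, that satisfies $w(t)\in\Omega$ for all $t\ge 0$, as well as $$\lim_{t\to+\infty}s_i(t)=0,\qquad \lim_{t\to+\infty}\frac{v_i(t)}{r_i(t)}=\omega^*,\qquad \lim_{t\to+\infty}\dot s_i(t)=0,\qquad \lim_{t\to+\infty}F_i(t)=0,\qquad i=1,\dots,n.$$ Furthermore, there exists a non-decreasing function $P_1:\mathbb R_+\to\mathbb R_+$ (not depending on $w_0$) such that, for every $w_0\in\Omega$, the corresponding solution satisfies $$|F_i(t)|+|\delta_i(t)|\le P_1(H(w_0))\quad\text{for all } t\ge 0,\ i=1,\dots,n.$$ Here $F_i(t)=F_i(w(t))$ and $\delta_i(t)=\delta_i(w(t))$.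
   Context: Notation: $\mathbb R_+=[0,+\infty)$. $n$ is a positive integer (number of vehicles). All sums $\sum_{j\ne i}$ run over $j\in\{1,\dots,n\}\setminus\{i\}$. Constants: $R_{out}>R_{in}>0$; $v_{\max}>0$; $\omega^*\in(0,v_{\max}/R_{out})$; $\Theta\in(0,\pi/2)$ with $\cos(\Theta)>R_{out}\omega^*/v_{\max}$; $\sigma_i>0$ ($i=1,\dots,n$); for $i\ne j$, $p_{i,j}=p_{j,i}>0$ and $L_{i,j}=L_{j,i}>0$; $\lambda>\max\{L_{i,j}: i\neq j\}$, $\lambda>0$; $A>0$; $b>1/R_{in}^2$; $\mu_1,\mu_2>0$. State: $w=(r_1,\dots,r_n,\varphi_1,\dots,\varphi_n,s_1,\dots,s_n,v_1,\dots,v_n)'\in\mathbb R^{4n}$. Distances: $d_{i,j}=\sqrt{p_{i,j}(r_i-r_j)^2+2r_ir_j(1-\cos(\varphi_i-\varphi_j))}$. Set $S=(R_{in},R_{out})^n\times\mathbb R^n\times(-\Theta,\Theta)^n\times(0,v_{\max})^n$ and state space $\Omega=\{w\in S: d_{i,j}>L_{i,j},\ i,j=1,\dots,n,\ j\ne i\}$ (an open set). Functions: for $i\neq j$, $V_{i,j}:(L_{i,j},+\infty)\to\mathbb R_+$ is $C^2$ with $\lim_{d\to L_{i,j}^+}V_{i,j}(d)=+\infty$, $V_{i,j}(d)=0$ for $d\ge\lambda$, $V_{i,j}\equiv V_{j,i}$; $U_i:(R_{in},R_{out})\to\mathbb R_+$ is $C^2$ with $\lim_{r\to R_{in}^+}U_i(r)=\lim_{r\to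 R_{out}^-}U_i(r)=+\infty$; for $i\ne j$, $\kappa_{i,j}:(L_{i,j},+\infty)\to\mathbb R_+$ is $C^1$ with $\kappa_{i,j}\equiv\kappa_{j,i}$ and $\kappa_{i,j}(d)=0$ for $d\ge\lambda$; $g_1,g_2:\mathbb R\to\mathbb R$ are $C^1$ and non-decreasing; $f:\mathbb R\to\mathbb R_+$ is $C^1$ with $f(x)\ge\max(0,x)$ for all $x\in\mathbb R$. Lyapunov function: for $w\in\Omega$, $$H(w)=\frac12\sum_{i=1}^n\Big(\frac{v_i}{r_i}\cos(s_i)-\omega^*\Big)^2+\frac b2\sum_{i=1}^n v_i^2\sin^2(s_i)+\sum_{i=1}^nU_i(r_i)+\frac12\sum_{i=1}^n\sum_{j\ne i}V_{i,j}(d_{i,j})+A\sum_{i=1}^n\Big(\frac1{\cos(s_i)-\cos(\Theta)}-\frac1{1-\cos(\Theta)}\Big).$$ Feedback laws (Newtonian Cruise Controller): for $w\in\Omega$ and $i=1,\dots,n$, $$F_i=-k_i(w)\Big(v_i-\frac{r_i\omega^*}{\cos(s_i)}\Big)-\frac{r_i\omega^*}{\cos(s_i)}\big(\Phi_i(w)-G_i(w)\big),$$ $$\delta_i=\tan^{-1}\Big(\frac{\sigma_i}{r_i}\cos(s_i)-\frac{\sigma_i}{v_i\,a(r_i,s_i,v_i)}\big(\mu_2\sin(s_i)+(bF_i\sin(s_i)+\Lambda_i(w))v_i-M_i(w)\big)\Big),$$ where $$k_i(w)=\mu_1+\Phi_i(w)-G_i(w)+f\Big(-\frac{v_{\max}\cos(s_i)}{v_{\max}\cos(s_i)-r_i\omega^*}\big(\Phi_i(w)-G_i(w)\big)\Big),$$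 $$a(r,s,v)=\Big(b-\frac1{r^2}\Big)v^2\cos(s)+\omega^*\frac vr+\frac{A}{(\cos(s)-\cos(\Theta))^2},$$ $$\Lambda_i(w)=\Big(\frac{v_i}{r_i}\cos(s_i)-\omega^*\Big)\frac{v_i}{r_i^2}\cos(s_i)-U_i'(r_i)-\sum_{j\ne i}\big(p_{i,j}(r_i-r_j)+r_j(1-\cos(\varphi_i-\varphi_j))\big)\frac{V_{i,j}'(d_{i,j})}{d_{i,j}},$$ $$\Phi_i(w)=\frac{r_i}{\omega^*}\sum_{j\ne i}V_{i,j}'(d_{i,j})\frac{r_j\sin(\varphi_i-\varphi_j)}{d_{i,j}},$$ $$G_i(w)=\frac1{\omega^*}\sum_{j\ne i}\kappa_{i,j}(d_{i,j})\Big(g_1\Big(\frac{v_j}{r_j}\cos(s_j)\Big)-g_1\Big(\frac{v_i}{r_i}\cos(s_i)\Big)\Big),$$ $$M_i(w)=\sum_{j\ne i}\kappa_{i,j}(d_{i,j})\big(g_2(\sin(s_j))-g_2(\sin(s_i))\big).$$ *)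

theory Defs
  imports "HOL-Analysis.Analysis"
begin

record 'n cruise_params =
  R_in :: real
  R_out :: real
  v_max :: real
  omega_star :: real
  Theta :: real
  sigma :: "'n \<Rightarrow> real"
  p_coef :: "'n \<Rightarrow> 'n \<Rightarrow> real"
  L_dist :: "'n \<Rightarrow> 'n \<Rightarrow> real"
  lam :: real
  A_gain :: real
  b_gain :: real
  mu1 :: real
  mu2 :: real
  V_pot :: "'n \<Rightarrow> 'n \<Rightarrow> real \<Rightarrow> real"
  U_pot :: "'n \<Rightarrow> real \<Rightarrow> real"
  kappa :: "'n \<Rightarrow> 'n \<Rightarrow> real \<Rightarrow> real"
  g1 :: "real \<Rightarrow> real"
  g2 :: "real \<Rightarrow> real"
  f_gain :: "real \<Rightarrow> real"

definition C2_differentiable_on :: "(real \<Rightarrow> real) \<Rightarrow> real set \<Rightarrow> bool" where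
  "C2_differentiable_on h S \<longleftrightarrow> h C1_differentiable_on S \<and> deriv h C1_differentiable_on S"

text \<open>The vehicles are the elements of the finite type \<open>'n\<close>. Functions with a restricted domain
  are total functions on the reals, and are constrained only on that domain; likewise the diagonal
  entries of doubly indexed data are unconstrained and never used.\<close>

locale cruise =
  fixes P :: "'n::finite cruise_params"
  assumes R_in_pos: "0 < R_in P"
    and R_in_less_R_out: "R_in P < R_out P"
    and v_max_pos: "0 < v_max P"
    and omega_star_pos: "0 < omega_star P"
    and omega_star_less: "omega_star P < v_max P / R_out P"
    and Theta_pos: "0 < Theta P"
    and Theta_less: "Theta P < pi / 2"
    and cos_Theta: "cos (Theta P) > R_out P * omega_star P / v_max P"
    and sigma_pos: "\<And>i. 0 < sigma P i"
    and p_pos: "\<And>i j. i \<noteq> j \<Longrightarrow> 0 < p_coef P i j"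
    and p_sym: "\<And>i j. i \<noteq> j \<Longrightarrow> p_coef P i j = p_coef P j i"
    and L_pos: "\<And>i j. i \<noteq> j \<Longrightarrow> 0 < L_dist P i j"
    and L_sym: "\<And>i j. i \<noteq> j \<Longrightarrow> L_dist P i j = L_dist P j i"
    and lam_pos: "0 < lam P"
    and L_less_lam: "\<And>i j. i \<noteq> j \<Longrightarrow> L_dist P i j < lam P"
    and A_pos: "0 < A_gain P"
    and b_gt: "b_gain P > 1 / (R_in P)\<^sup>2"
    and mu1_pos: "0 < mu1 P"
    and mu2_pos: "0 < mu2 P"
    and V_C2: "\<And>i j. i \<noteq> j \<Longrightarrow> C2_differentiable_on (V_pot P i j) {L_dist P i j<..}"
    and V_nonneg: "\<And>i j d. i \<noteq> j \<Longrightarrow> L_dist P i j < d \<Longrightarrow> 0 \<le> V_pot P i j d"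
    and V_lim: "\<And>i j. i \<noteq> j \<Longrightarrow> filterlim (V_pot P i j) at_top (at_right (L_dist P i j))"
    and V_zero: "\<And>i j d. i \<noteq> j \<Longrightarrow> lam P \<le> d \<Longrightarrow> V_pot P i j d = 0"
    and V_sym: "\<And>i j d. i \<noteq> j \<Longrightarrow> L_dist P i j < d \<Longrightarrow> V_pot P i j d = V_pot P j i d"
    and U_C2: "\<And>i. C2_differentiable_on (U_pot P i) {R_in P<..<R_out P}"
    and U_nonneg: "\<And>i r. R_in P < r \<Longrightarrow> r < R_out P \<Longrightarrow> 0 \<le> U_pot P i r"
    and U_lim_in: "\<And>i. filterlim (U_pot P i) at_top (at_right (R_in P))"
    and U_lim_out: "\<And>i. filterlim (U_pot P i) at_top (at_left (R_out P))"
    and kappa_C1: "\<And>i j. i \<noteq> j \<Longrightarrow> kappa P i j C1_differentiable_on {L_dist P i j<..}"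
    and kappa_nonneg: "\<And>i j d. i \<noteq> j \<Longrightarrow> L_dist P i j < d \<Longrightarrow> 0 \<le> kappa P i j d"
    and kappa_sym: "\<And>i j d. i \<noteq> j \<Longrightarrow> L_dist P i j < d \<Longrightarrow> kappa P i j d = kappa P j i d"
    and kappa_zero: "\<And>i j d. i \<noteq> j \<Longrightarrow> lam P \<le> d \<Longrightarrow> kappa P i j d = 0"
    and g1_C1: "g1 P C1_differentiable_on UNIV"
    and g1_mono: "mono (g1 P)"
    and g2_C1: "g2 P C1_differentiable_on UNIV"
    and g2_mono: "mono (g2 P)"
    and f_C1: "f_gain P C1_differentiable_on UNIV"
    and f_ge: "\<And>x. f_gain P x \<ge> max 0 x"

type_synonym 'n state = "(real^'n) \<times> (real^'n) \<times> (real^'n) \<times> (real^'n)"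

definition rad :: "'n::finite state \<Rightarrow> 'n \<Rightarrow> real" where
  "rad w i = fst w $ i"

definition phi :: "'n::finite state \<Rightarrow> 'n \<Rightarrow> real" where
  "phi w i = fst (snd w) $ i"

definition hdg :: "'n::finite state \<Rightarrow> 'n \<Rightarrow> real" where
  "hdg w i = fst (snd (snd w)) $ i"

definition spd :: "'n::finite state \<Rightarrow> 'n \<Rightarrow> real" where
  "spd w i = snd (snd (snd w)) $ i"

definition dst :: "'n::finite cruise_params \<Rightarrow> 'n state \<Rightarrow> 'n \<Rightarrow> 'n \<Rightarrow> real" where
  "dst P w i j = sqrt (p_coef P i j * (rad w i - rad w j)\<^sup>2
      + 2 * rad w i * rad w j * (1 - cos (phi w i - phi w j)))"

definition Omega :: "'n::finite cruise_params \<Rightarrow> 'n state set" where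
  "Omega P = {w. (\<forall>i. rad w i \<in> {R_in P<..<R_out P} \<and> hdg w i \<in> {- Theta P<..<Theta P}
                     \<and> spd w i \<in> {0<..<v_max P})
                \<and> (\<forall>i j. j \<noteq> i \<longrightarrow> dst P w i j > L_dist P i j)}"

definition H :: "'n::finite cruise_params \<Rightarrow> 'n state \<Rightarrow> real" where
  "H P w =
     1/2 * (\<Sum>i\<in>UNIV. (spd w i / rad w i * cos (hdg w i) - omega_star P)\<^sup>2)
     + b_gain P / 2 * (\<Sum>i\<in>UNIV. (spd w i)\<^sup>2 * (sin (hdg w i))\<^sup>2)
     + (\<Sum>i\<in>UNIV. U_pot P i (rad w i))
     + 1/2 * (\<Sum>i\<in>UNIV. \<Sum>j\<in>UNIV - {i}. V_pot P i j (dst P w i j))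
     + A_gain P * (\<Sum>i\<in>UNIV. 1 / (cos (hdg w i) - cos (Theta P)) - 1 / (1 - cos (Theta P)))"

definition Phi :: "'n::finite cruise_params \<Rightarrow> 'n state \<Rightarrow> 'n \<Rightarrow> real" where
  "Phi P w i = rad w i / omega_star P *
     (\<Sum>j\<in>UNIV - {i}. deriv (V_pot P i j) (dst P w i j) *
        (rad w j * sin (phi w i - phi w j) / dst P w i j))"

definition G :: "'n::finite cruise_params \<Rightarrow> 'n state \<Rightarrow> 'n \<Rightarrow> real" where
  "G P w i = 1 / omega_star P *
     (\<Sum>j\<in>UNIV - {i}. kappa P i j (dst P w i j) *
        (g1 P (spd w j / rad w j * cos (hdg w j)) - g1 P (spd w i / rad w i * cos (hdg w i))))"

definition M :: "'n::finite cruise_params \<Rightarrow> 'n state \<Rightarrow> 'n \<Rightarrow> real" where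
  "M P w i = (\<Sum>j\<in>UNIV - {i}. kappa P i j (dst P w i j) *
     (g2 P (sin (hdg w j)) - g2 P (sin (hdg w i))))"

definition Lambda :: "'n::finite cruise_params \<Rightarrow> 'n state \<Rightarrow> 'n \<Rightarrow> real" where
  "Lambda P w i =
     (spd w i / rad w i * cos (hdg w i) - omega_star P) * (spd w i / (rad w i)\<^sup>2) * cos (hdg w i)
     - deriv (U_pot P i) (rad w i)
     - (\<Sum>j\<in>UNIV - {i}.
          (p_coef P i j * (rad w i - rad w j) + rad w j * (1 - cos (phi w i - phi w j))) *
          (deriv (V_pot P i j) (dst P w i j) / dst P w i j))"

definition a_fun :: "'n::finite cruise_params \<Rightarrow> real \<Rightarrow> real \<Rightarrow> real \<Rightarrow> real" where
  "a_fun P r s v = (b_gain P - 1 / r\<^sup>2) * v\<^sup>2 * cos s + omega_star P * (v / r)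
     + A_gain P / (cos s - cos (Theta P))\<^sup>2"

definition k_gain :: "'n::finite cruise_params \<Rightarrow> 'n state \<Rightarrow> 'n \<Rightarrow> real" where
  "k_gain P w i = mu1 P + Phi P w i - G P w i
     + f_gain P (- (v_max P * cos (hdg w i) / (v_max P * cos (hdg w i) - rad w i * omega_star P))
                  * (Phi P w i - G P w i))"

definition F :: "'n::finite cruise_params \<Rightarrow> 'n state \<Rightarrow> 'n \<Rightarrow> real" where
  "F P w i = - k_gain P w i * (spd w i - rad w i * omega_star P / cos (hdg w i))
     - rad w i * omega_star P / cos (hdg w i) * (Phi P w i - G P w i)"

definition delta :: "'n::finite cruise_params \<Rightarrow> 'n state \<Rightarrow> 'n \<Rightarrow> real" where
  "delta P w i = arctan (sigma P i / rad w i * cos (hdg w i)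
     - sigma P i / (spd w i * a_fun P (rad w i) (hdg w i) (spd w i)) *
       (mu2 P * sin (hdg w i)
        + (b_gain P * F P w i * sin (hdg w i) + Lambda P w i) * spd w i
        - M P w i))"

text \<open>The closed loop is an ODE on the open set \<open>Omega P\<close>, since the feedback laws are meaningful
  only there; a solution on a time interval \<open>I\<close> therefore takes values in \<open>Omega P\<close>. Derivatives at
  endpoints of \<open>I\<close> are one-sided.\<close>

definition closed_loop_solution ::
  "'n::finite cruise_params \<Rightarrow> 'n state \<Rightarrow> real set \<Rightarrow> (real \<Rightarrow> 'n state) \<Rightarrow> bool" where
  "closed_loop_solution P w0 I w \<longleftrightarrow>
     is_interval I \<and> 0 \<in> I \<and> w 0 = w0 \<and>
     (\<forall>t\<in>I. w t \<in> Omega P \<and>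
       (\<forall>i. ((\<lambda>\<tau>. rad (w \<tau>) i) has_real_derivative
                - spd (w t) i * sin (hdg (w t) i)) (at t within I)
          \<and> ((\<lambda>\<tau>. phi (w \<tau>) i) has_real_derivative
                spd (w t) i / rad (w t) i * cos (hdg (w t) i)) (at t within I)
          \<and> ((\<lambda>\<tau>. hdg (w \<tau>) i) has_real_derivative
                spd (w t) i / sigma P i * tan (delta P (w t) i)
                - spd (w t) i / rad (w t) i * cos (hdg (w t) i)) (at t within I)
          \<and> ((\<lambda>\<tau>. spd (w \<tau>) i) has_real_derivative F P (w t) i) (at t within I)))"

end

theory Submission
  imports Defs
begin

text \<open>The function \<open>H\<close> decreases along the closed loop, its sublevel sets keep the vehicles away from every
part of the boundary of \<open>Omega P\<close> except the two faces \<open>spd = 0\<close> and \<open>spd = v_max\<close>, and on those two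
faces the acceleration \<open>F\<close> points inwards. This keeps solutions in a set on which the closed loop is
Lipschitz, which gives global existence; convergence is then an application of Barbalat's lemma.

Dissipation. Write \<open>x\<close> for the angular velocity error \<open>ang_err\<close> of a vehicle, \<open>s\<close> for its heading, \<open>v\<close>
for its speed and \<open>a\<close> for \<open>a_fun\<close>. Since \<open>delta\<close> is an arctangent, the closed-loop heading rate is
explicit: \<open>-(mu2 sin s + (b F sin s + Lambda) v - M) / a\<close>. It contains no division by the speed, so it
is regular up to \<open>spd = 0\<close>. The heading rate enters the derivative of \<open>H\<close> exactly with the factor
\<open>a sin s\<close>, and the acceleration with the factor \<open>x cos s / r\<close> apart from a term that \<open>delta\<close> compensates. What
remains per vehicle is \<open>- k x\<^sup>2 + omega_star x G - mu2 sin\<^sup>2 s + sin s M\<close>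
(\<open>single_vehicle_balance\<close>, \<open>H_has_derivative\<close>); the forces \<open>Phi\<close> cancel in the sum because they are
antisymmetric in the pair of vehicles. The viscous terms \<open>G\<close> and \<open>M\<close> only help
(\<open>sum_consensus_nonpos\<close>), and \<open>f_gain\<close> is chosen so that \<open>k \<ge> mu1\<close>. Hence \<open>H\<close> decreases at least at the
rate of the sum of \<open>mu1 x\<^sup>2 + mu2 sin\<^sup>2 s\<close> (\<open>H_rate_le\<close>).

Existence. By coercivity (\<open>sublevel_subset_inner_core\<close>) a sublevel set of \<open>H\<close> in \<open>Omega P\<close> lies in
\<open>inner_core P e\<close> for some \<open>e > 0\<close>, an open set whose closure lies in \<open>core P e\<close>. On \<open>core P e\<close> every
ingredient of the feedback is bounded and Lipschitz: each is built from coordinates and from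
trigonometric functions of angle differences by arithmetic and by composition with \<open>C\<^sup>1\<close> functions of one
variable, on compact subintervals of their domains. The set \<open>core P e\<close> itself need not be convex, and the angles
\<open>phi\<close> make it unbounded, so these estimates are not obtained from derivatives of the vector field. The
restriction of the vector field to \<open>core P e\<close> extends to a globally Lipschitz one
(\<open>lipschitz_extension\<close>), whose solution exists for all times (\<open>lipschitz_ode_exists\<close>). This solution
cannot leave \<open>inner_core P e\<close> (\<open>no_exit_from_inner_core\<close>), so it solves the original system. Every other
solution is confined to the same set by the decrease of \<open>H\<close>, hence agrees with it.

Convergence. Along the solution every bounded Lipschitz function of the state is Lipschitz in time.
Barbalat's lemma, applied to \<open>H\<close>, shows that its derivative tends to zero, so \<open>x\<close> and \<open>sin s\<close> do; applied
to \<open>s\<close> and to \<open>x\<close>, it shows that the heading rate and the derivative of \<open>x\<close> tend to zero, and \<open>F\<close> can be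
recovered from these two rates. The uniform bound holds because \<open>F\<close> is bounded on sublevel sets of \<open>H\<close>
and an arctangent is at most \<open>pi / 2\<close>.\<close>

section \<open>Globally Lipschitz differential equations\<close>

text \<open>McShane's extension: the infimum of the cones of slope \<open>L\<close> with vertices on the graph of \<open>f\<close>.\<close>
lemma lipschitz_extension_real:
  fixes f :: "'a::metric_space \<Rightarrow> real"
  assumes f: "L-lipschitz_on K f"
  obtains g where "L-lipschitz_on UNIV g" "\<And>x. x \<in> K \<Longrightarrow> g x = f x"
proof (cases "K = {}")
  case True
  show ?thesis
    by (rule that[of "\<lambda>_. 0"]) (use True lipschitz_on_nonneg[OF f] in \<open>auto simp: lipschitz_on_def\<close>)
next
  case False
  then obtain y0 where y0: "y0 \<in> K" by blast
  have L: "L \<ge> 0" by (rule lipschitz_on_nonneg[OF f])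
  define g where "g x = (INF y\<in>K. f y + L * dist x y)" for x
  have fL: "f x \<le> f y + L * dist x y" if "x \<in> K" "y \<in> K" for x y
    using lipschitz_onD[OF f that] by (auto simp: dist_real_def)
  have bdd: "bdd_below ((\<lambda>y. f y + L * dist x y) ` K)" for x
  proof (rule bdd_belowI2)
    fix y assume "y \<in> K"
    have "f y0 \<le> f y + L * dist y0 y" using fL y0 \<open>y \<in> K\<close> by blast
    also have "L * dist y0 y \<le> L * (dist x y0 + dist x y)"
      by (intro mult_left_mono L) (metis dist_commute dist_triangle)
    finally show "f y0 - L * dist x y0 \<le> f y + L * dist x y" by (simp add: algebra_simps)
  qed
  have g_le: "g x \<le> f y + L * dist x y" if "y \<in> K" for x y
    unfolding g_def by (rule cINF_lower[OF bdd that])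
  have g_ge: "c \<le> g x" if "\<And>y. y \<in> K \<Longrightarrow> c \<le> f y + L * dist x y" for x c
    unfolding g_def by (rule cINF_greatest[OF False that])
  have one: "g x - L * dist x x' \<le> g x'" for x x'
  proof (rule g_ge)
    fix y assume "y \<in> K"
    have "g x \<le> f y + L * dist x y" by (rule g_le[OF \<open>y \<in> K\<close>])
    also have "L * dist x y \<le> L * (dist x x' + dist x' y)"
      by (intro mult_left_mono L dist_triangle)
    finally show "g x - L * dist x x' \<le> f y + L * dist x' y" by (simp add: algebra_simps)
  qed
  show ?thesis
  proof (rule that)
    show "L-lipschitz_on UNIV g"
    proof (rule lipschitz_onI[OF _ L])
      fix x y show "dist (g x) (g y) \<le> L * dist x y"
        using one[of x y] one[of y x] by (auto simp: dist_real_def dist_commute abs_le_iff)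
    qed
    fix x assume x: "x \<in> K"
    show "g x = f x"
      by (rule antisym) (use g_le[OF x, of x] in simp, rule g_ge, rule fL[OF x])
  qed
qed

text \<open>Extending coordinatewise enlarges the constant by the factor \<open>DIM('b)\<close>; only its existence matters below.\<close>
lemma lipschitz_extension:
  fixes f :: "'a::metric_space \<Rightarrow> 'b::euclidean_space"
  assumes f: "L-lipschitz_on K f"
  obtains g M where "M-lipschitz_on UNIV g" "\<And>x. x \<in> K \<Longrightarrow> g x = f x"
proof -
  have L: "L \<ge> 0" by (rule lipschitz_on_nonneg[OF f])
  have "\<exists>g. L-lipschitz_on UNIV g \<and> (\<forall>x\<in>K. g x = f x \<bullet> b)" if b: "b \<in> Basis" for b
  proof -
    have "L-lipschitz_on K (\<lambda>x. f x \<bullet> b)"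
    proof (rule lipschitz_onI[OF _ L])
      fix x y assume xy: "x \<in> K" "y \<in> K"
      have "dist (f x \<bullet> b) (f y \<bullet> b) = \<bar>(f x - f y) \<bullet> b\<bar>"
        by (simp add: dist_real_def inner_diff_left)
      also have "\<dots> \<le> norm (f x - f y)" by (rule Basis_le_norm[OF b])
      also have "\<dots> \<le> L * dist x y" using lipschitz_onD[OF f xy] by (simp add: dist_norm)
      finally show "dist (f x \<bullet> b) (f y \<bullet> b) \<le> L * dist x y" .
    qed
    from lipschitz_extension_real[OF this] show ?thesis by metis
  qed
  then obtain g where g: "\<And>b. b \<in> Basis \<Longrightarrow> L-lipschitz_on UNIV (g b)"
    "\<And>b x. b \<in> Basis \<Longrightarrow> x \<in> K \<Longrightarrow> g b x = f x \<bullet> b" by metis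
  show ?thesis
  proof (rule that)
    show "(\<Sum>b\<in>(Basis::'b set). L)-lipschitz_on UNIV (\<lambda>x. \<Sum>b\<in>Basis. g b x *\<^sub>R b)"
    proof (rule lipschitz_onI)
      fix x y
      have "dist (\<Sum>b\<in>Basis. g b x *\<^sub>R b) (\<Sum>b\<in>Basis. g b y *\<^sub>R b)
          = norm (\<Sum>b\<in>Basis. (g b x - g b y) *\<^sub>R (b::'b))"
        by (simp add: dist_norm sum_subtractf scaleR_diff_left)
      also have "\<dots> \<le> (\<Sum>b\<in>(Basis::'b set). L * dist x y)"
        by (rule sum_norm_le) (use lipschitz_onD[OF g(1), of _ x y] in \<open>auto simp: dist_real_def\<close>)
      finally show "dist (\<Sum>b\<in>Basis. g b x *\<^sub>R b) (\<Sum>b\<in>Basis. g b y *\<^sub>R b)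
          \<le> (\<Sum>b\<in>(Basis::'b set). L) * dist x y" by (simp add: sum_distrib_right)
    qed (use L in \<open>simp add: sum_nonneg\<close>)
    fix x assume "x \<in> K"
    then have "(\<Sum>b\<in>Basis. g b x *\<^sub>R b) = (\<Sum>b\<in>Basis. (f x \<bullet> b) *\<^sub>R b)" by (simp add: g(2))
    then show "(\<Sum>b\<in>Basis. g b x *\<^sub>R b) = f x" by (simp add: euclidean_representation)
  qed
qed

lemma integral_from_0_has_vector_derivative:
  fixes h :: "real \<Rightarrow> 'a::banach"
  assumes h: "continuous_on {0..} h" and t: "t \<ge> 0"
  shows "((\<lambda>t. integral {0..t} h) has_vector_derivative h t) (at t within {0..})"
proof -
  have "((\<lambda>t. integral {0..t} h) has_vector_derivative h t) (at t within {0..t + 1})"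
    by (rule integral_has_vector_derivative) (use h t in \<open>auto intro: continuous_on_subset\<close>)
  moreover have "at t within {0..t + 1} = at t within {0..}"
    by (rule at_within_nhd[of _ "{..<t + 1}"]) auto
  ultimately show ?thesis by simp
qed

text \<open>The factor \<open>1 / c\<close> gained by an exponential weight is what makes the Picard operator a contraction on
the whole half-line at once.\<close>
lemma weighted_integral_bound:
  fixes h :: "real \<Rightarrow> 'a::banach"
  assumes h: "continuous_on {0..} h" and C: "C \<ge> 0" "c > 0" and t: "t \<ge> 0"
    and bound: "\<And>\<tau>. \<tau> \<ge> 0 \<Longrightarrow> norm (h \<tau>) \<le> C * exp (c * \<tau>)"
  shows "norm (exp (- c * t) *\<^sub>R integral {0..t} h) \<le> C / c"
proof -
  have "((\<lambda>\<tau>. C * exp (c * \<tau>)) has_integral C * exp (c * t) / c - C * exp (c * 0) / c) {0..t}"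
    by (rule fundamental_theorem_of_calculus[OF t])
      (use C in \<open>auto intro!: derivative_eq_intros simp: has_real_derivative_iff_has_vector_derivative[symmetric]\<close>)
  moreover have "h integrable_on {0..t}"
    by (rule integrable_continuous_interval) (use h in \<open>auto intro: continuous_on_subset\<close>)
  ultimately have "norm (integral {0..t} h) \<le> C * exp (c * t) / c - C * exp (c * 0) / c"
    using integral_norm_bound_integral[of h "{0..t}" "\<lambda>\<tau>. C * exp (c * \<tau>)"] bound
    by (auto simp: has_integral_integrable_integral)
  also have "\<dots> \<le> C * exp (c * t) / c" using C by simp
  finally have "exp (- c * t) * norm (integral {0..t} h) \<le> exp (- c * t) * (C * exp (c * t) / c)"
    by (intro mult_left_mono) auto
  also have "\<dots> = C / c" by (simp add: exp_minus field_simps)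
  finally show ?thesis by simp
qed

text \<open>The unknown is the weighted deviation \<open>u t = exp (- c t) (w t - w0)\<close>, which is bounded because a
solution of a Lipschitz equation grows at most exponentially. In this variable the Picard operator maps
bounded continuous functions to bounded continuous functions and contracts by \<open>L / c\<close>, so Banach's
theorem yields the solution on all of \<open>{0..}\<close> without continuation of local solutions.\<close>
lemma lipschitz_ode_exists:
  fixes g :: "'a::banach \<Rightarrow> 'a"
  assumes g: "L-lipschitz_on UNIV g"
  obtains w where "w 0 = w0"
    and "\<And>t. t \<ge> 0 \<Longrightarrow> (w has_vector_derivative g (w t)) (at t within {0..})"
proof -
  have L: "L \<ge> 0" by (rule lipschitz_on_nonneg[OF g])
  have gL: "norm (g x - g y) \<le> L * norm (x - y)" for x y
    using lipschitz_onD[OF g, of x y] by (simp add: dist_norm)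
  have g_cont: "continuous_on S g" for S
    using lipschitz_on_continuous_on[OF g] continuous_on_subset by blast
  define c where "c = L + 1"
  have c: "c > 0" using L by (simp add: c_def)
  define path where "path u t = w0 + exp (c * t) *\<^sub>R apply_bcontfun u t" for u :: "real \<Rightarrow>\<^sub>C 'a" and t
  \<comment> \<open>Functions in the Banach space live on the whole line; \<open>max 0 t\<close> extends them constantly to
  negative times.\<close>
  define S where "S u t = exp (- c * max 0 t) *\<^sub>R integral {0..max 0 t} (\<lambda>\<tau>. g (path u \<tau>))" for u t
  have path_cont: "continuous_on A (path u)" for A u
    unfolding path_def by (intro continuous_intros continuous_on_apply_bcontfun)
  have gpath_cont: "continuous_on A (\<lambda>\<tau>. g (path u \<tau>))" for A u
    by (rule continuous_on_compose2[OF g_cont path_cont]) auto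
  have S_bcontfun: "S u \<in> bcontfun" for u
  proof (rule bcontfun_normI)
    have "continuous_on {0..} (\<lambda>t. integral {0..t} (\<lambda>\<tau>. g (path u \<tau>)))"
      using integral_from_0_has_vector_derivative[OF gpath_cont]
      by (auto simp: continuous_on_eq_continuous_within intro: has_vector_derivative_continuous)
    then show "continuous_on UNIV (S u)" unfolding S_def
      by (intro continuous_intros continuous_on_compose2[of "{0..}" _ UNIV "max 0"]) auto
    fix t
    show "norm (S u t) \<le> (norm (g w0) + L * norm u) / c"
      unfolding S_def
    proof (rule weighted_integral_bound[OF gpath_cont _ c])
      fix \<tau> :: real assume \<tau>: "\<tau> \<ge> 0"
      have "norm (g (path u \<tau>)) \<le> norm (g w0) + norm (g (path u \<tau>) - g w0)" by (rule norm_triangle_sub)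
      also have "norm (g (path u \<tau>) - g w0) \<le> L * (exp (c * \<tau>) * norm (apply_bcontfun u \<tau>))"
        using gL[of "path u \<tau>" w0] by (simp add: path_def)
      also have "\<dots> \<le> L * (exp (c * \<tau>) * norm u)"
        by (intro mult_left_mono norm_bounded L) auto
      also have "norm (g w0) \<le> norm (g w0) * exp (c * \<tau>)"
        using \<tau> c by (simp add: mult_le_cancel_left1)
      finally show "norm (g (path u \<tau>)) \<le> (norm (g w0) + L * norm u) * exp (c * \<tau>)"
        by (simp add: algebra_simps)
    qed (use L in auto)
  qed
  have contraction: "dist (Bcontfun (S u)) (Bcontfun (S v)) \<le> L / c * dist u v" for u v
  proof (rule dist_bound)
    fix t :: real
    let ?m = "max 0 t"
    have "S u t - S v t = exp (- c * ?m) *\<^sub>R integral {0..?m} (\<lambda>\<tau>. g (path u \<tau>) - g (path v \<tau>))"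
      unfolding S_def by (subst integral_diff)
        (auto intro!: integrable_continuous_interval gpath_cont simp: scaleR_diff_right)
    also have "norm \<dots> \<le> (L * dist u v) / c"
    proof (rule weighted_integral_bound[OF _ _ c])
      fix \<tau> :: real
      have "norm (g (path u \<tau>) - g (path v \<tau>)) \<le> L * norm (path u \<tau> - path v \<tau>)" by (rule gL)
      also have "path u \<tau> - path v \<tau> = exp (c * \<tau>) *\<^sub>R (apply_bcontfun u \<tau> - apply_bcontfun v \<tau>)"
        by (simp add: path_def scaleR_diff_right)
      also have "norm \<dots> = exp (c * \<tau>) * dist (apply_bcontfun u \<tau>) (apply_bcontfun v \<tau>)"
        by (simp add: dist_norm)
      also have "L * \<dots> \<le> L * (exp (c * \<tau>) * dist u v)"
        by (intro mult_left_mono dist_bounded L) auto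
      finally show "norm (g (path u \<tau>) - g (path v \<tau>)) \<le> L * dist u v * exp (c * \<tau>)"
        by (simp add: algebra_simps)
    qed (use L in \<open>auto intro!: continuous_intros gpath_cont\<close>)
    finally show "dist (apply_bcontfun (Bcontfun (S u)) t) (apply_bcontfun (Bcontfun (S v)) t) \<le> L / c * dist u v"
      by (simp add: Bcontfun_inverse S_bcontfun dist_norm)
  qed
  have "\<exists>!u. Bcontfun (S u) = u"
    by (rule banach_fix_type[of "L / c"]) (use L contraction in \<open>auto simp: c_def\<close>)
  then obtain u where "Bcontfun (S u) = u" by blast
  then have fix_u: "apply_bcontfun u = S u" by (metis Bcontfun_inverse S_bcontfun)
  have path_eq: "path u t = w0 + integral {0..t} (\<lambda>\<tau>. g (path u \<tau>))" if "t \<ge> 0" for t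
    using that unfolding path_def[of u t] fix_u S_def by (simp add: exp_minus)
  show ?thesis
  proof (rule that[of "path u"])
    show "path u 0 = w0" using path_eq[of 0] by simp
    fix t :: real assume t: "t \<ge> 0"
    have "((\<lambda>t. w0 + integral {0..t} (\<lambda>\<tau>. g (path u \<tau>))) has_vector_derivative g (path u t)) (at t within {0..})"
      using has_vector_derivative_add[OF has_vector_derivative_const[of w0]
        integral_from_0_has_vector_derivative[OF gpath_cont[of _ u] t]] by simp
    then show "(path u has_vector_derivative g (path u t)) (at t within {0..})"
      by (rule has_vector_derivative_transform[rotated 2]) (use t path_eq in auto)
  qed
qed

lemma nonincreasing_if_derivative_nonpos:
  fixes f f' :: "real \<Rightarrow> real"
  assumes "a \<le> b"
    and d: "\<And>x. x \<in> {a..b} \<Longrightarrow> (f has_real_derivative f' x) (at x within {a..b})"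
    and n: "\<And>x. x \<in> {a..b} \<Longrightarrow> f' x \<le> 0"
  shows "f b \<le> f a"
proof (cases "a = b")
  case False
  then have "a < b" using assms by simp
  then obtain x where x: "x \<in> {a<..<b}" "f b - f a = f' x * (b - a)"
    using mvt_simple[of a b f "\<lambda>x. (*) (f' x)"] d unfolding has_field_derivative_def by auto
  then have "f' x * (b - a) \<le> 0" using n \<open>a < b\<close> by (intro mult_nonpos_nonneg) auto
  then show ?thesis using x by simp
qed simp

text \<open>Gronwall's argument: the squared distance of two solutions, weighted by \<open>exp (- 2 L t)\<close>, cannot increase.\<close>
lemma lipschitz_ode_unique:
  fixes g :: "'a::real_inner \<Rightarrow> 'a"
  assumes g: "L-lipschitz_on UNIV g" and T: "0 \<le> T"
    and w: "\<And>t. t \<in> {0..T} \<Longrightarrow> (w has_vector_derivative g (w t)) (at t within {0..T})"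
    and z: "\<And>t. t \<in> {0..T} \<Longrightarrow> (z has_vector_derivative g (z t)) (at t within {0..T})"
    and "w 0 = z 0"
  shows "w T = z T"
proof -
  define N where "N t = exp (- 2 * L * t) * ((w t - z t) \<bullet> (w t - z t))" for t
  define N' where "N' t = exp (- 2 * L * t) *
    (2 * ((w t - z t) \<bullet> (g (w t) - g (z t))) - 2 * L * ((w t - z t) \<bullet> (w t - z t)))" for t
  have "N T \<le> N 0"
  proof (rule nonincreasing_if_derivative_nonpos[OF T])
    fix t assume t: "t \<in> {0..T}"
    have wz: "((\<lambda>t. w t - z t) has_vector_derivative g (w t) - g (z t)) (at t within {0..T})"
      by (intro has_vector_derivative_diff w z t)
    have ip: "((\<lambda>t. (w t - z t) \<bullet> (w t - z t)) has_real_derivative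
        2 * ((w t - z t) \<bullet> (g (w t) - g (z t)))) (at t within {0..T})"
      using bounded_bilinear.has_vector_derivative[OF bounded_bilinear_inner wz wz]
      unfolding has_real_derivative_iff_has_vector_derivative by (simp only: inner_commute mult_2)
    show "(N has_real_derivative N' t) (at t within {0..T})"
      unfolding N_def[abs_def] N'_def
      by (rule derivative_eq_intros ip refl)+ (simp add: right_diff_distrib mult.assoc)
    have "(w t - z t) \<bullet> (g (w t) - g (z t)) \<le> norm (w t - z t) * norm (g (w t) - g (z t))"
      by (rule norm_cauchy_schwarz)
    also have "\<dots> \<le> norm (w t - z t) * (L * norm (w t - z t))"
      using lipschitz_onD[OF g, of "w t" "z t"] by (intro mult_left_mono) (auto simp: dist_norm)
    also have "\<dots> = L * ((w t - z t) \<bullet> (w t - z t))" by (simp add: power2_norm_eq_inner[symmetric] power2_eq_square)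
    finally show "N' t \<le> 0" unfolding N'_def by (intro mult_nonneg_nonpos) auto
  qed
  then have "N T \<le> 0" using assms by (simp add: N_def)
  then have "(w T - z T) \<bullet> (w T - z T) \<le> 0" unfolding N_def by (simp add: mult_le_0_iff)
  then show ?thesis by (metis antisym eq_iff_diff_eq_0 inner_eq_zero_iff inner_ge_zero)
qed

text \<open>By the mean value theorem a difference quotient of \<open>y\<close> over a step \<open>h\<close> is a value of \<open>y'\<close> within distance
\<open>h\<close>, hence within \<open>C h\<close> of \<open>y' t\<close>; for fixed \<open>h\<close> the quotient tends to zero because \<open>y\<close> converges.\<close>
lemma Barbalat:
  fixes y y' :: "real \<Rightarrow> real"
  assumes y: "(y \<longlongrightarrow> l) at_top"
    and d: "\<And>t. t \<ge> 0 \<Longrightarrow> (y has_real_derivative y' t) (at t within {0..})"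
    and lip: "C-lipschitz_on {0..} y'"
  shows "(y' \<longlongrightarrow> 0) at_top"
proof (rule tendstoI)
  fix \<epsilon> :: real assume \<epsilon>: "\<epsilon> > 0"
  have C: "C \<ge> 0" by (rule lipschitz_on_nonneg[OF lip])
  \<comment> \<open>Adding 1 to \<open>C\<close> keeps the step finite when \<open>C = 0\<close>.\<close>
  define h where "h = \<epsilon> / (2 * (C + 1))"
  have h: "h > 0" "C * h < \<epsilon> / 2" using \<epsilon> C by (auto simp: h_def field_simps)
  have "((\<lambda>t. (y (t + h) - y t) / h) \<longlongrightarrow> (l - l) / h) at_top"
    using h by (intro tendsto_intros y filterlim_compose[OF y]
      filterlim_at_top_mono[OF filterlim_ident]) (auto intro: always_eventually)
  then have "eventually (\<lambda>t. dist ((y (t + h) - y t) / h) 0 < \<epsilon> / 2) at_top"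
    using \<epsilon> by (intro tendstoD) auto
  then show "eventually (\<lambda>t. dist (y' t) 0 < \<epsilon>) at_top"
    using eventually_ge_at_top[of 0]
  proof eventually_elim
    case (elim t)
    have "(y has_derivative (*) (y' x)) (at x within {t..t + h})" if "x \<in> {t..t + h}" for x
      using d[of x] that elim(2) unfolding has_field_derivative_def
      by (auto elim!: has_derivative_subset)
    then have "\<exists>x\<in>{t<..<t + h}. y (t + h) - y t = y' x * (t + h - t)"
      using mvt_simple[of t "t + h" y "\<lambda>x. (*) (y' x)"] h by auto
    then obtain x where x: "x \<in> {t<..<t + h}" "y (t + h) - y t = y' x * h" by auto
    have "\<bar>y' t - y' x\<bar> \<le> C * \<bar>t - x\<bar>"
      using lipschitz_onD[OF lip, of t x] x elim(2) by (simp add: dist_real_def)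
    also have "\<dots> \<le> C * h" using x C by (intro mult_left_mono) auto
    finally have "\<bar>y' t - y' x\<bar> < \<epsilon> / 2" using h by simp
    moreover have "\<bar>y' x\<bar> < \<epsilon> / 2" using elim(1) x h by (simp add: dist_real_def)
    ultimately show ?case unfolding dist_real_def by linarith
  qed
qed

section \<open>Bounded Lipschitz functions\<close>

text \<open>Boundedness is part of the notion because products of Lipschitz functions are Lipschitz only for
bounded factors. The domain is arbitrary, in particular not convex: compositions only involve
intervals of the real line.\<close>
definition bl_on :: "'a::metric_space set \<Rightarrow> ('a \<Rightarrow> real) \<Rightarrow> bool" where
  "bl_on K f \<longleftrightarrow> (\<exists>B C. (\<forall>x\<in>K. \<bar>f x\<bar> \<le> B) \<and> C-lipschitz_on K f)"

lemma bl_onI: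
  assumes "\<And>x. x \<in> K \<Longrightarrow> \<bar>f x\<bar> \<le> B" "C-lipschitz_on K f"
  shows "bl_on K f"
  using assms unfolding bl_on_def by auto

lemma bl_on_const: "bl_on K (\<lambda>_. c)"
  by (rule bl_onI[OF _ lipschitz_on_constant]) auto

lemma bl_on_add:
  assumes "bl_on K f" "bl_on K g" shows "bl_on K (\<lambda>x. f x + g x)"
proof -
  obtain B C where f: "\<And>x. x \<in> K \<Longrightarrow> \<bar>f x\<bar> \<le> B" "C-lipschitz_on K f" using assms(1) by (auto simp: bl_on_def)
  obtain B' C' where g: "\<And>x. x \<in> K \<Longrightarrow> \<bar>g x\<bar> \<le> B'" "C'-lipschitz_on K g" using assms(2) by (auto simp: bl_on_def)
  show ?thesis
    by (rule bl_onI[OF _ lipschitz_on_add[OF f(2) g(2)], of "B + B'"]) (use f(1) g(1) in fastforce)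
qed

lemma bl_on_mult:
  assumes "bl_on K f" "bl_on K g" shows "bl_on K (\<lambda>x. f x * g x)"
proof -
  obtain B C where f: "\<And>x. x \<in> K \<Longrightarrow> \<bar>f x\<bar> \<le> B" "C-lipschitz_on K f" using assms(1) by (auto simp: bl_on_def)
  obtain B' C' where g: "\<And>x. x \<in> K \<Longrightarrow> \<bar>g x\<bar> \<le> B'" "C'-lipschitz_on K g" using assms(2) by (auto simp: bl_on_def)
  have C: "C \<ge> 0" "C' \<ge> 0" using f(2) g(2) by (auto dest: lipschitz_on_nonneg)
  show ?thesis
  proof (rule bl_onI)
    fix x assume x: "x \<in> K"
    show "\<bar>f x * g x\<bar> \<le> B * B'"
      unfolding abs_mult by (intro mult_mono f g x) (use f(1)[OF x] in auto)
  next
    show "(\<bar>B\<bar> * C' + \<bar>B'\<bar> * C)-lipschitz_on K (\<lambda>x. f x * g x)"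
    proof (rule lipschitz_onI)
      fix x y assume xy: "x \<in> K" "y \<in> K"
      have "f x * g x - f y * g y = f x * (g x - g y) + g y * (f x - f y)" by (simp add: algebra_simps)
      then have "dist (f x * g x) (f y * g y) \<le> \<bar>f x\<bar> * \<bar>g x - g y\<bar> + \<bar>g y\<bar> * \<bar>f x - f y\<bar>"
        by (metis dist_real_def abs_mult abs_triangle_ineq)
      also have "\<dots> \<le> \<bar>B\<bar> * (C' * dist x y) + \<bar>B'\<bar> * (C * dist x y)"
        using f(1)[OF xy(1)] g(1)[OF xy(2)] lipschitz_onD[OF f(2) xy] lipschitz_onD[OF g(2) xy]
        by (intro add_mono mult_mono) (auto simp: dist_real_def)
      finally show "dist (f x * g x) (f y * g y) \<le> (\<bar>B\<bar> * C' + \<bar>B'\<bar> * C) * dist x y"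
        by (simp add: algebra_simps)
    qed (use C in simp)
  qed
qed

lemma bl_on_minus: "bl_on K f \<Longrightarrow> bl_on K (\<lambda>x. - f x)"
  using bl_on_mult[OF bl_on_const[of K "-1"], of f] by simp

lemma bl_on_diff: "bl_on K f \<Longrightarrow> bl_on K g \<Longrightarrow> bl_on K (\<lambda>x. f x - g x)"
  using bl_on_add[OF _ bl_on_minus, of K f g] by simp

lemma bl_on_power2: "bl_on K f \<Longrightarrow> bl_on K (\<lambda>x. (f x)\<^sup>2)"
  unfolding power2_eq_square by (rule bl_on_mult)

lemma bl_on_sum: "(\<And>i. i \<in> A \<Longrightarrow> bl_on K (f i)) \<Longrightarrow> bl_on K (\<lambda>x. \<Sum>i\<in>A. f i x)"
  by (induction A rule: infinite_finite_induct) (auto intro: bl_on_const bl_on_add)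

lemma C1_imp_lipschitz_on_interval:
  fixes h :: "real \<Rightarrow> real"
  assumes h: "h C1_differentiable_on S" and S: "{a..b} \<subseteq> S"
  obtains C where "C-lipschitz_on {a..b} h"
proof -
  obtain D where D: "\<And>x. x \<in> S \<Longrightarrow> (h has_vector_derivative D x) (at x)" "continuous_on S D"
    using h unfolding C1_differentiable_on_def by blast
  have "compact (D ` {a..b})"
    by (intro compact_continuous_image continuous_on_subset[OF D(2) S]) auto
  then have "bounded (D ` {a..b})" by (rule compact_imp_bounded)
  then obtain C where C: "C > 0" "\<forall>x\<in>{a..b}. \<bar>D x\<bar> \<le> C"
    unfolding bounded_pos by auto
  have "C-lipschitz_on {a..b} h"
  proof (rule bounded_derivative_imp_lipschitz)
    fix x assume x: "x \<in> {a..b}"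
    show "(h has_derivative (\<lambda>y. y *\<^sub>R D x)) (at x within {a..b})"
      by (rule has_derivative_at_withinI[OF D(1)[unfolded has_vector_derivative_def]]) (use S x in blast)
    show "onorm (\<lambda>y. y *\<^sub>R D x) \<le> C"
    proof (rule onorm_le)
      fix y :: real
      have "\<bar>D x\<bar> * \<bar>y\<bar> \<le> C * \<bar>y\<bar>" using C x by (intro mult_right_mono) auto
      then show "norm (y *\<^sub>R D x) \<le> C * norm y" by (simp add: abs_mult mult.commute)
    qed
  qed (use C in auto)
  then show ?thesis by (rule that)
qed

text \<open>A \<open>C\<^sup>1\<close> function is Lipschitz only on compact parts of its domain, so the values of \<open>f\<close> must stay
in a compact subinterval.\<close>
lemma bl_on_compose_interval:
  assumes f: "bl_on K f" and h: "h C1_differentiable_on S" "{a..b} \<subseteq> S"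
    and range: "\<And>x. x \<in> K \<Longrightarrow> f x \<in> {a..b}"
  shows "bl_on K (\<lambda>x. h (f x))"
proof -
  obtain B C where C: "\<And>x. x \<in> K \<Longrightarrow> \<bar>f x\<bar> \<le> B" "C-lipschitz_on K f" using f by (auto simp: bl_on_def)
  obtain M where M: "M-lipschitz_on {a..b} h" by (rule C1_imp_lipschitz_on_interval[OF h])
  have sub: "f ` K \<subseteq> {a..b}" using range by auto
  have "bounded (h ` {a..b})"
    by (intro compact_imp_bounded compact_continuous_image lipschitz_on_continuous_on[OF M]) auto
  then obtain B' where "\<forall>x\<in>{a..b}. \<bar>h x\<bar> \<le> B'" unfolding bounded_iff by auto
  moreover have "(M * C)-lipschitz_on K (\<lambda>x. h (f x))"
    by (rule lipschitz_on_compose2[OF C(2) lipschitz_on_subset[OF M sub]])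
  ultimately show ?thesis using range by (intro bl_onI[of K _ B' "M * C"]) blast+
qed

lemma bl_on_compose_above:
  assumes f: "bl_on K f" and h: "h C1_differentiable_on {l<..}" "l < a"
    and range: "\<And>x. x \<in> K \<Longrightarrow> a \<le> f x"
  shows "bl_on K (\<lambda>x. h (f x))"
proof -
  obtain B C where "\<And>x. x \<in> K \<Longrightarrow> \<bar>f x\<bar> \<le> B" "C-lipschitz_on K f" using f by (auto simp: bl_on_def)
  then have "f x \<in> {a..B}" if "x \<in> K" for x using range[OF that] that by fastforce
  moreover have "{a..B} \<subseteq> {l<..}" using h(2) by auto
  ultimately show ?thesis by (intro bl_on_compose_interval[OF f h(1)])
qed

lemma bl_on_compose:
  assumes f: "bl_on K f" and h: "h C1_differentiable_on UNIV"
  shows "bl_on K (\<lambda>x. h (f x))"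
proof -
  obtain B C where "\<And>x. x \<in> K \<Longrightarrow> \<bar>f x\<bar> \<le> B" "C-lipschitz_on K f" using f by (auto simp: bl_on_def)
  then have "f x \<in> {- B..B}" if "x \<in> K" for x using that by (fastforce simp: abs_le_iff)
  then show ?thesis by (intro bl_on_compose_interval[OF f h subset_UNIV])
qed

lemma C1_sin: "(sin :: real \<Rightarrow> real) C1_differentiable_on UNIV"
  unfolding C1_differentiable_on_def
  by (rule exI[of _ cos]) (auto intro!: continuous_intros DERIV_sin simp: has_real_derivative_iff_has_vector_derivative[symmetric])

lemma C1_cos: "(cos :: real \<Rightarrow> real) C1_differentiable_on UNIV"
  unfolding C1_differentiable_on_def
  by (rule exI[of _ "\<lambda>x. - sin x"]) (auto intro!: continuous_intros DERIV_cos simp: has_real_derivative_iff_has_vector_derivative[symmetric])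

lemma C1_inverse: "(inverse :: real \<Rightarrow> real) C1_differentiable_on {0<..}"
  unfolding C1_differentiable_on_def
  by (rule exI[of _ "\<lambda>x. - (inverse x * inverse x)"])
    (auto intro!: continuous_intros derivative_eq_intros simp: has_real_derivative_iff_has_vector_derivative[symmetric])

lemma C1_sqrt: "sqrt C1_differentiable_on {0<..}"
  unfolding C1_differentiable_on_def
  by (rule exI[of _ "\<lambda>x. inverse (sqrt x) / 2"])
    (auto intro!: continuous_intros DERIV_real_sqrt simp: has_real_derivative_iff_has_vector_derivative[symmetric])

lemmas bl_on_sin = bl_on_compose[OF _ C1_sin]
lemmas bl_on_cos = bl_on_compose[OF _ C1_cos]

lemma bl_on_divide:
  assumes "bl_on K f" "bl_on K g" and "0 < c" "\<And>x. x \<in> K \<Longrightarrow> c \<le> g x"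
  shows "bl_on K (\<lambda>x. f x / g x)"
  unfolding divide_inverse
  by (intro bl_on_mult assms bl_on_compose_above[OF assms(2) C1_inverse assms(3)])

section \<open>Sums over pairs of vehicles\<close>

lemma sum_offdiag_swap:
  fixes f :: "'n::finite \<Rightarrow> 'n \<Rightarrow> real"
  shows "(\<Sum>i\<in>UNIV. \<Sum>j\<in>UNIV - {i}. f i j) = (\<Sum>i\<in>UNIV. \<Sum>j\<in>UNIV - {i}. f j i)"
proof -
  have "(\<Sum>i\<in>UNIV. \<Sum>j\<in>UNIV - {i}. f i j) = (\<Sum>i\<in>UNIV. \<Sum>j\<in>UNIV. if i \<noteq> j then f i j else 0)" for f :: "'n \<Rightarrow> 'n \<Rightarrow> real"
    by (intro sum.cong refl sum.mono_neutral_cong_left) auto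
  then show ?thesis
    by (simp add: sum.swap[of "\<lambda>i j. if i \<noteq> j then f i j else 0"] eq_commute)
qed

lemma sum_offdiag_symmetrize:
  fixes f :: "'n::finite \<Rightarrow> 'n \<Rightarrow> real"
  shows "(\<Sum>i\<in>UNIV. \<Sum>j\<in>UNIV - {i}. f i j + f j i) = 2 * (\<Sum>i\<in>UNIV. \<Sum>j\<in>UNIV - {i}. f i j)"
  using sum_offdiag_swap[of f] by (simp add: sum.distrib)

text \<open>Summation by parts: exchanging the two members of a pair turns the sum into one half of the sum of
\<open>- q i j (y j - y i) (g (y j) - g (y i))\<close>, and \<open>g\<close> is monotone. The constant \<open>c\<close> disappears in the
differences.\<close>
lemma sum_consensus_nonpos:
  fixes q :: "'n::finite \<Rightarrow> 'n \<Rightarrow> real" and y :: "'n \<Rightarrow> real"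
  assumes q: "\<And>i j. i \<noteq> j \<Longrightarrow> 0 \<le> q i j" "\<And>i j. i \<noteq> j \<Longrightarrow> q i j = q j i" and g: "mono g"
  shows "(\<Sum>i\<in>UNIV. (y i - c) * (\<Sum>j\<in>UNIV - {i}. q i j * (g (y j) - g (y i)))) \<le> 0"
proof -
  define T where "T i j = (y i - c) * (q i j * (g (y j) - g (y i)))" for i j
  have "2 * (\<Sum>i\<in>UNIV. (y i - c) * (\<Sum>j\<in>UNIV - {i}. q i j * (g (y j) - g (y i))))
      = (\<Sum>i\<in>UNIV. \<Sum>j\<in>UNIV - {i}. T i j + T j i)"
    unfolding sum_offdiag_symmetrize by (simp add: T_def sum_distrib_left)
  also have "\<dots> \<le> 0"
  proof (intro sum_nonpos)
    fix i j :: 'n assume "j \<in> UNIV - {i}"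
    then have "T i j + T j i = - (q i j * ((y j - y i) * (g (y j) - g (y i))))"
      using q(2)[of i j] by (simp add: T_def algebra_simps)
    moreover have "(y j - y i) * (g (y j) - g (y i)) \<ge> 0"
      using monoD[OF g, of "y i" "y j"] monoD[OF g, of "y j" "y i"]
      by (cases "y i \<le> y j") (auto intro: mult_nonneg_nonneg mult_nonpos_nonpos)
    ultimately show "T i j + T j i \<le> 0" using q(1)[of i j] \<open>j \<in> UNIV - {i}\<close> by auto
  qed
  finally show ?thesis by simp
qed

section \<open>The closed loop as an autonomous vector field\<close>

definition ang_err :: "'n::finite cruise_params \<Rightarrow> 'n state \<Rightarrow> 'n \<Rightarrow> real" where
  "ang_err P w i = spd w i / rad w i * cos (hdg w i) - omega_star P"

text \<open>The heading rate of the closed loop after cancellation of \<open>tan\<close> against \<open>arctan\<close>. In contrast to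
\<open>delta\<close> it makes sense at speed zero.\<close>
definition hdg_rate :: "'n::finite cruise_params \<Rightarrow> 'n state \<Rightarrow> 'n \<Rightarrow> real" where
  "hdg_rate P w i = - (mu2 P * sin (hdg w i)
      + (b_gain P * F P w i * sin (hdg w i) + Lambda P w i) * spd w i - M P w i)
      / a_fun P (rad w i) (hdg w i) (spd w i)"

text \<open>The derivative of \<open>ang_err\<close> along the closed loop, by the quotient and product rules.\<close>
definition ang_err_rate :: "'n::finite cruise_params \<Rightarrow> 'n state \<Rightarrow> 'n \<Rightarrow> real" where
  "ang_err_rate P w i = F P w i * cos (hdg w i) / rad w i
      - spd w i * sin (hdg w i) * hdg_rate P w i / rad w i
      + (spd w i)\<^sup>2 * sin (hdg w i) * cos (hdg w i) / (rad w i)\<^sup>2"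

text \<open>The derivative of \<open>H\<close> along the closed loop, in the form from which its sign can be read off.\<close>
definition H_rate :: "'n::finite cruise_params \<Rightarrow> 'n state \<Rightarrow> real" where
  "H_rate P w = (\<Sum>i\<in>UNIV. - k_gain P w i * (ang_err P w i)\<^sup>2 + omega_star P * (ang_err P w i * G P w i)
      - mu2 P * (sin (hdg w i))\<^sup>2 + sin (hdg w i) * M P w i)"

definition vfield :: "'n::finite cruise_params \<Rightarrow> 'n state \<Rightarrow> 'n state" where
  "vfield P w = ((\<chi> i. - spd w i * sin (hdg w i)), (\<chi> i. spd w i / rad w i * cos (hdg w i)),
     (\<chi> i. hdg_rate P w i), (\<chi> i. F P w i))"

text \<open>The state space with the boundary speeds included: all cancellations in the derivative of \<open>H\<close> are valid
here, and the trajectory may be evaluated at the instant at which it would leave \<open>Omega P\<close> through such a face.\<close>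
definition Omega_ext :: "'n::finite cruise_params \<Rightarrow> 'n state set" where
  "Omega_ext P = {w. (\<forall>i. rad w i \<in> {R_in P<..<R_out P} \<and> \<bar>hdg w i\<bar> < Theta P
                     \<and> spd w i \<in> {0..v_max P})
                \<and> (\<forall>i j. j \<noteq> i \<longrightarrow> dst P w i j > L_dist P i j)}"

text \<open>One margin \<open>e\<close> serves all constraints. The heading is kept away from \<open>\<plusminus> Theta\<close> by a condition on its
cosine, the quantity that \<open>H\<close> penalises. The speeds get no margin, since \<open>H\<close> does not control them. The
condition \<open>\<bar>hdg w i\<bar> \<le> Theta P\<close> selects one period of the cosine.\<close>
definition core :: "'n::finite cruise_params \<Rightarrow> real \<Rightarrow> 'n state set" where
  "core P e = {w. (\<forall>i. rad w i \<in> {R_in P + e..R_out P - e} \<and> \<bar>hdg w i\<bar> \<le> Theta P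
                     \<and> cos (Theta P) + e \<le> cos (hdg w i) \<and> spd w i \<in> {0..v_max P})
                \<and> (\<forall>i j. j \<noteq> i \<longrightarrow> L_dist P i j + e \<le> dst P w i j)}"

definition inner_core :: "'n::finite cruise_params \<Rightarrow> real \<Rightarrow> 'n state set" where
  "inner_core P e = {w. (\<forall>i. rad w i \<in> {R_in P + e<..<R_out P - e} \<and> \<bar>hdg w i\<bar> < Theta P
                     \<and> cos (Theta P) + e < cos (hdg w i) \<and> spd w i \<in> {0<..<v_max P})
                \<and> (\<forall>i j. j \<noteq> i \<longrightarrow> L_dist P i j + e < dst P w i j)}"

section \<open>Regularity of the feedback on the core\<close>

lemma lipschitz_coordinates:
  shows lipschitz_rad: "1-lipschitz_on K (\<lambda>w. rad w i)"
    and lipschitz_phi: "1-lipschitz_on K (\<lambda>w. phi w i)"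
    and lipschitz_hdg: "1-lipschitz_on K (\<lambda>w. hdg w i)"
    and lipschitz_spd: "1-lipschitz_on K (\<lambda>w. spd w i)"
  unfolding rad_def phi_def hdg_def spd_def lipschitz_on_def mult_1
  by (meson dist_vec_nth_le dist_fst_le dist_snd_le order_trans zero_le_one)+

lemma lipschitz_sin: "1-lipschitz_on UNIV (sin :: real \<Rightarrow> real)"
proof (rule bounded_derivative_imp_lipschitz)
  fix x :: real
  show "(sin has_derivative (\<lambda>y. y * cos x)) (at x within UNIV)"
    using DERIV_sin[of x] by (simp add: has_field_derivative_def mult.commute[of _ "cos x"])
  show "onorm (\<lambda>y. y * cos x) \<le> 1"
    by (rule onorm_le) (simp add: abs_mult mult_left_le)
qed auto

text \<open>For the unbounded angles \<open>phi\<close>: the sine of a function that is Lipschitz but possibly unbounded.\<close>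
lemma bl_sin_lipschitz:
  assumes "C-lipschitz_on K f" shows "bl_on K (\<lambda>x. sin (f x))"
  by (rule bl_onI[OF _ lipschitz_on_compose2[OF assms lipschitz_on_subset[OF lipschitz_sin]], of 1]) auto

lemma bl_on_sin_angle: "bl_on K (\<lambda>w. sin (phi w i - phi w j))"
  by (rule bl_sin_lipschitz[OF lipschitz_on_diff[OF lipschitz_phi lipschitz_phi]])

lemma bl_on_cos_angle: "bl_on K (\<lambda>w. cos (phi w i - phi w j))"
proof -
  have "bl_on K (\<lambda>w. sin (phi w i - phi w j + pi / 2))"
    by (rule bl_sin_lipschitz[OF lipschitz_on_add[OF lipschitz_on_diff[OF lipschitz_phi lipschitz_phi] lipschitz_on_constant]])
  then show ?thesis by (simp add: sin_add)
qed

lemma bl_on_divide_const: "bl_on K f \<Longrightarrow> bl_on K (\<lambda>x. f x / c)"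
  using bl_on_mult[OF _ bl_on_const[of K "1 / c"], of f] by simp

context cruise
begin

lemma cos_Theta_pos: "0 < cos (Theta P)"
  using Theta_pos Theta_less by (intro cos_gt_zero_pi) auto

lemma cos_heading: "\<bar>s\<bar> < Theta P \<Longrightarrow> cos (Theta P) < cos s"
  using cos_monotone_0_pi[of "\<bar>s\<bar>" "Theta P"] Theta_less Theta_pos by simp

lemma speed_margin:
  assumes "r \<le> R_out P" "cos (Theta P) \<le> c"
  shows "v_max P * cos (Theta P) - R_out P * omega_star P \<le> v_max P * c - r * omega_star P"
  using assms omega_star_pos v_max_pos by (intro diff_mono mult_left_mono mult_right_mono) auto

lemma speed_margin_pos: "0 < v_max P * cos (Theta P) - R_out P * omega_star P"
  using cos_Theta v_max_pos by (simp add: field_simps)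

lemma b_gain_pos: "0 < b_gain P"
  using b_gt R_in_pos by (meson less_trans zero_less_divide_1_iff zero_less_power)

text \<open>This is where the lower bound on \<open>b_gain\<close> enters: it makes the first summand nonnegative, so that \<open>a_fun\<close>
is bounded away from zero uniformly in the speed, including speed zero.\<close>
lemma a_fun_ge:
  assumes "R_in P < r" "cos (Theta P) < cos s" "0 \<le> v"
  shows "A_gain P \<le> a_fun P r s v"
proof -
  have "1 / r\<^sup>2 \<le> 1 / (R_in P)\<^sup>2"
    using assms R_in_pos by (intro divide_left_mono power_mono) auto
  then have "0 \<le> (b_gain P - 1 / r\<^sup>2) * v\<^sup>2 * cos s"
    using b_gt assms cos_Theta_pos by (intro mult_nonneg_nonneg) auto
  moreover have "0 \<le> omega_star P * (v / r)" using assms R_in_pos omega_star_pos by simp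
  moreover have "A_gain P \<le> A_gain P / (cos s - cos (Theta P))\<^sup>2"
  proof -
    have "cos s - cos (Theta P) \<le> 1" using cos_le_one[of s] cos_Theta_pos by linarith
    then have "(cos s - cos (Theta P))\<^sup>2 \<le> 1" using assms by (intro power_le_one) auto
    then show ?thesis using assms A_pos by (simp add: field_simps)
  qed
  ultimately show ?thesis unfolding a_fun_def by linarith
qed

lemma core_facts:
  assumes "w \<in> core P e"
  shows "R_in P + e \<le> rad w i" "rad w i \<le> R_out P - e" "\<bar>hdg w i\<bar> \<le> Theta P"
    "cos (Theta P) + e \<le> cos (hdg w i)" "0 \<le> spd w i" "spd w i \<le> v_max P"
    "j \<noteq> i \<Longrightarrow> L_dist P i j + e \<le> dst P w i j"
  using assms unfolding core_def by simp_all

lemma core_subset_Omega_ext: "0 < e \<Longrightarrow> core P e \<subseteq> Omega_ext P"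
proof
  fix w assume e: "0 < e" and w: "w \<in> core P e"
  have "\<bar>hdg w i\<bar> < Theta P" for i
  proof -
    have "\<bar>hdg w i\<bar> \<noteq> Theta P" using core_facts(4)[OF w, of i] e by (metis cos_abs_real less_add_same_cancel1 linorder_not_less)
    then show ?thesis using core_facts(3)[OF w, of i] by linarith
  qed
  moreover have "rad w i \<in> {R_in P<..<R_out P}" "spd w i \<in> {0..v_max P}" for i
    using core_facts[OF w] e by (auto intro: less_le_trans[of _ "R_in P + e"] le_less_trans[of _ "R_out P - e"])
  moreover have "dst P w i j > L_dist P i j" if "j \<noteq> i" for i j
    using core_facts(7)[OF w that] e by linarith
  ultimately show "w \<in> Omega_ext P" unfolding Omega_ext_def by blast
qed

lemma inner_core_subset_core: "inner_core P e \<subseteq> core P e"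
  unfolding inner_core_def core_def by (rule Collect_mono) (simp add: less_imp_le)

lemma inner_core_subset_Omega: "0 < e \<Longrightarrow> inner_core P e \<subseteq> Omega P"
proof
  fix w assume e: "0 < e" and w: "w \<in> inner_core P e"
  have "w \<in> Omega_ext P" using w inner_core_subset_core core_subset_Omega_ext[OF e] by blast
  moreover have "spd w i \<in> {0<..<v_max P}" for i using w unfolding inner_core_def by blast
  ultimately show "w \<in> Omega P"
    unfolding Omega_ext_def Omega_def by (simp add: abs_less_iff) (metis minus_less_iff)
qed

lemma Omega_subset_Omega_ext: "Omega P \<subseteq> Omega_ext P"
  unfolding Omega_def Omega_ext_def by (rule Collect_mono) (simp add: abs_less_iff less_imp_le minus_less_iff[of _ "Theta P"])

lemma Omega_ext_facts:
  assumes "w \<in> Omega_ext P"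
  shows "R_in P < rad w i" "rad w i < R_out P" "0 < rad w i" "cos (Theta P) < cos (hdg w i)" "0 < cos (hdg w i)"
    "0 \<le> spd w i" "spd w i \<le> v_max P" "0 < a_fun P (rad w i) (hdg w i) (spd w i)"
    "j \<noteq> i \<Longrightarrow> L_dist P i j < dst P w i j" "j \<noteq> i \<Longrightarrow> 0 < dst P w i j"
    "0 < v_max P * cos (hdg w i) - rad w i * omega_star P"
    "cos (hdg w i) \<noteq> 0" "rad w i \<noteq> 0" "cos (hdg w i) - cos (Theta P) \<noteq> 0"
proof -
  show *: "R_in P < rad w i" "rad w i < R_out P" "0 \<le> spd w i" "spd w i \<le> v_max P"
    "j \<noteq> i \<Longrightarrow> L_dist P i j < dst P w i j"
    using assms unfolding Omega_ext_def by simp_all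
  show c: "cos (Theta P) < cos (hdg w i)" using assms cos_heading unfolding Omega_ext_def by simp
  then show "0 < cos (hdg w i)" "cos (hdg w i) \<noteq> 0" "cos (hdg w i) - cos (Theta P) \<noteq> 0" using cos_Theta_pos by auto
  show "0 < rad w i" "rad w i \<noteq> 0" using * R_in_pos by auto
  show "0 < a_fun P (rad w i) (hdg w i) (spd w i)"
    using a_fun_ge[OF *(1) c *(3)] A_pos by simp
  show "j \<noteq> i \<Longrightarrow> 0 < dst P w i j" using *(5) L_pos[of i j] by (metis less_trans)
  show "0 < v_max P * cos (hdg w i) - rad w i * omega_star P"
    using speed_margin[of "rad w i" "cos (hdg w i)"] speed_margin_pos *(2) c by simp
qed

end

locale cruise_core = cruise P for P :: "'n::finite cruise_params" +
  fixes e :: real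
  assumes e_pos: "0 < e"
begin

abbreviation "bl \<equiv> bl_on (core P e)"

lemmas in_ext = subsetD[OF core_subset_Omega_ext[OF e_pos]]

lemma bl_rad: "bl (\<lambda>w. rad w i)"
  by (rule bl_onI[OF _ lipschitz_rad, of _ _ "R_out P"])
    (use Omega_ext_facts(2,3)[OF in_ext] in \<open>simp add: less_imp_le\<close>)

lemma bl_hdg: "bl (\<lambda>w. hdg w i)"
  by (rule bl_onI[OF _ lipschitz_hdg, of _ _ "Theta P"]) (rule core_facts(3))

lemma bl_spd: "bl (\<lambda>w. spd w i)"
  by (rule bl_onI[OF _ lipschitz_spd, of _ _ "v_max P"]) (use core_facts(5,6) in simp)

lemmas bl_basic = bl_rad bl_spd bl_on_sin_angle bl_on_cos_angle bl_on_sin[OF bl_hdg] bl_on_cos[OF bl_hdg]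
  bl_on_const bl_on_add bl_on_minus bl_on_diff bl_on_mult bl_on_power2 bl_on_sum bl_on_divide_const

lemma bl_divide_rad: "bl f \<Longrightarrow> bl (\<lambda>w. f w / rad w i)"
  by (rule bl_on_divide[OF _ bl_rad R_in_pos]) (use Omega_ext_facts(1)[OF in_ext] in \<open>simp_all add: less_imp_le\<close>)

lemma bl_divide_rad2: "bl f \<Longrightarrow> bl (\<lambda>w. f w / (rad w i)\<^sup>2)"
  using bl_divide_rad[OF bl_divide_rad, of f i i] by (simp add: power2_eq_square)

lemma bl_divide_cos: "bl f \<Longrightarrow> bl (\<lambda>w. f w / cos (hdg w i))"
  by (rule bl_on_divide[OF _ bl_on_cos[OF bl_hdg] cos_Theta_pos])
    (use Omega_ext_facts(4)[OF in_ext] in \<open>simp_all add: less_imp_le\<close>)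

text \<open>The square root is singular at zero, but the distances exceed \<open>L_dist\<close>.\<close>
lemma bl_dst:
  assumes "i \<noteq> j" shows "bl (\<lambda>w. dst P w i j)"
  unfolding dst_def
proof (rule bl_on_compose_above[OF _ C1_sqrt])
  show "bl (\<lambda>w. p_coef P i j * (rad w i - rad w j)\<^sup>2
      + 2 * rad w i * rad w j * (1 - cos (phi w i - phi w j)))"
    by (intro bl_basic)
  show "0 < (L_dist P i j)\<^sup>2" using L_pos[OF assms] by simp
  fix w assume w: "w \<in> core P e"
  let ?q = "p_coef P i j * (rad w i - rad w j)\<^sup>2 + 2 * rad w i * rad w j * (1 - cos (phi w i - phi w j))"
  have "L_dist P i j < sqrt ?q"
    using Omega_ext_facts(9)[OF in_ext[OF w], of j i] assms unfolding dst_def by simp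
  moreover have "0 < ?q" using calculation L_pos[OF assms] by (meson less_trans real_sqrt_gt_0_iff)
  ultimately have "(L_dist P i j)\<^sup>2 \<le> (sqrt ?q)\<^sup>2"
    using L_pos[OF assms] by (intro power_mono) auto
  also have "\<dots> = ?q" using \<open>0 < ?q\<close> by simp
  finally show "(L_dist P i j)\<^sup>2 \<le> ?q" .
qed

lemma bl_of_dst:
  assumes "i \<noteq> j" and "h C1_differentiable_on {L_dist P i j<..}"
  shows "bl (\<lambda>w. h (dst P w i j))"
  by (rule bl_on_compose_above[OF bl_dst[OF assms(1)] assms(2), of "L_dist P i j + e"])
    (use e_pos core_facts(7)[of _ e j i] assms(1) in simp_all)

lemma bl_divide_dst:
  assumes "i \<noteq> j" "bl f" shows "bl (\<lambda>w. f w / dst P w i j)"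
  by (rule bl_on_divide[OF assms(2) bl_dst[OF assms(1)] L_pos[OF assms(1)]])
    (use Omega_ext_facts(9)[OF in_ext, of _ j i] assms(1) in \<open>simp add: less_imp_le\<close>)

lemma bl_dV: "i \<noteq> j \<Longrightarrow> bl (\<lambda>w. deriv (V_pot P i j) (dst P w i j))"
  by (rule bl_of_dst) (use V_C2 in \<open>auto simp: C2_differentiable_on_def\<close>)

lemma bl_kappa: "i \<noteq> j \<Longrightarrow> bl (\<lambda>w. kappa P i j (dst P w i j))"
  by (rule bl_of_dst) (use kappa_C1 in auto)

lemma bl_dU: "bl (\<lambda>w. deriv (U_pot P i) (rad w i))"
  by (rule bl_on_compose_interval[OF bl_rad, of _ "{R_in P<..<R_out P}" "R_in P + e" "R_out P - e"])
    (use U_C2[of i] e_pos core_facts(1,2) in \<open>simp_all add: C2_differentiable_on_def subset_iff\<close>)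

lemma bl_Phi: "bl (\<lambda>w. Phi P w i)"
  unfolding Phi_def by (intro bl_basic bl_dV bl_divide_dst) auto

lemma bl_G: "bl (\<lambda>w. G P w i)"
  unfolding G_def by (intro bl_basic bl_kappa bl_divide_rad bl_on_compose[OF _ g1_C1]) auto

lemma bl_M: "bl (\<lambda>w. M P w i)"
  unfolding M_def by (intro bl_basic bl_kappa bl_on_compose[OF _ g2_C1]) auto

lemma bl_Lambda: "bl (\<lambda>w. Lambda P w i)"
  unfolding Lambda_def by (intro bl_basic bl_divide_rad bl_divide_rad2 bl_dU bl_dV bl_divide_dst) auto

lemma bl_k_gain: "bl (\<lambda>w. k_gain P w i)"
proof -
  have "bl (\<lambda>w. v_max P * cos (hdg w i) / (v_max P * cos (hdg w i) - rad w i * omega_star P))"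
  proof (rule bl_on_divide[OF _ _ speed_margin_pos])
    fix w assume "w \<in> core P e"
    then show "v_max P * cos (Theta P) - R_out P * omega_star P \<le> v_max P * cos (hdg w i) - rad w i * omega_star P"
      using Omega_ext_facts(2,4)[OF in_ext] by (intro speed_margin) (simp_all add: less_imp_le)
  qed (intro bl_basic)+
  then show ?thesis
    unfolding k_gain_def by (intro bl_on_compose[OF _ f_C1] bl_basic bl_Phi bl_G)
qed

lemma bl_F: "bl (\<lambda>w. F P w i)"
  unfolding F_def by (intro bl_basic bl_k_gain bl_divide_cos bl_Phi bl_G)

lemma bl_a_fun: "bl (\<lambda>w. a_fun P (rad w i) (hdg w i) (spd w i))"
proof -
  have "bl (\<lambda>w. A_gain P / (cos (hdg w i) - cos (Theta P))\<^sup>2)"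
  proof (rule bl_on_divide[of _ _ _ "e\<^sup>2"])
    fix w assume "w \<in> core P e"
    then show "e\<^sup>2 \<le> (cos (hdg w i) - cos (Theta P))\<^sup>2"
      using core_facts(4)[of w e i] e_pos by (intro power_mono) auto
  qed (use e_pos in \<open>auto intro!: bl_basic\<close>)
  then show ?thesis unfolding a_fun_def by (intro bl_basic bl_divide_rad bl_divide_rad2)
qed

lemma bl_hdg_rate: "bl (\<lambda>w. hdg_rate P w i)"
  unfolding hdg_rate_def
proof (rule bl_on_divide[OF _ bl_a_fun A_pos])
  fix w assume "w \<in> core P e"
  then show "A_gain P \<le> a_fun P (rad w i) (hdg w i) (spd w i)"
    using Omega_ext_facts(1,4,6)[OF in_ext] by (intro a_fun_ge) simp_all
qed (intro bl_basic bl_F bl_Lambda bl_M)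

lemma bl_ang_err: "bl (\<lambda>w. ang_err P w i)"
  unfolding ang_err_def by (intro bl_basic bl_divide_rad)

lemma bl_ang_err_rate: "bl (\<lambda>w. ang_err_rate P w i)"
  unfolding ang_err_rate_def by (intro bl_basic bl_F bl_hdg_rate bl_divide_rad bl_divide_rad2)

lemma bl_H_rate: "bl (H_rate P)"
  unfolding H_rate_def[abs_def] by (intro bl_basic bl_k_gain bl_G bl_M bl_ang_err)

end

lemma bl_vec_lambda:
  fixes f :: "'a::metric_space \<Rightarrow> 'n::finite \<Rightarrow> real"
  assumes "\<And>i. bl_on K (\<lambda>w. f w i)"
  shows "\<exists>B C. (\<forall>w\<in>K. norm (\<chi> i. f w i) \<le> B) \<and> C-lipschitz_on K (\<lambda>w. \<chi> i. f w i)"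
proof -
  have "\<forall>i. \<exists>B C. (\<forall>w\<in>K. \<bar>f w i\<bar> \<le> B) \<and> C-lipschitz_on K (\<lambda>w. f w i)"
    using assms unfolding bl_on_def by blast
  then obtain B C where BC: "\<And>i w. w \<in> K \<Longrightarrow> \<bar>f w i\<bar> \<le> B i" "\<And>i. (C i)-lipschitz_on K (\<lambda>w. f w i)"
    by metis
  have "norm (\<chi> i. f w i) \<le> sum B UNIV" if "w \<in> K" for w
    by (rule order_trans[OF norm_le_l1_cart sum_mono]) (use BC(1) that in auto)
  moreover have "(sum C UNIV)-lipschitz_on K (\<lambda>w. \<chi> i. f w i)"
  proof (rule lipschitz_onI)
    fix x y assume xy: "x \<in> K" "y \<in> K"
    have "dist (\<chi> i. f x i) (\<chi> i. f y i) \<le> (\<Sum>i\<in>UNIV. \<bar>f x i - f y i\<bar>)"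
      unfolding dist_norm by (rule order_trans[OF norm_le_l1_cart]) simp
    also have "\<dots> \<le> (\<Sum>i\<in>UNIV. C i * dist x y)"
      using lipschitz_onD[OF BC(2) xy] by (intro sum_mono) (simp add: dist_real_def)
    finally show "dist (\<chi> i. f x i) (\<chi> i. f y i) \<le> sum C UNIV * dist x y" by (simp add: sum_distrib_right)
  qed (auto intro: sum_nonneg lipschitz_on_nonneg[OF BC(2)])
  ultimately show ?thesis by blast
qed

lemma (in cruise_core) vfield_bounded_lipschitz:
  obtains B C where "\<And>w. w \<in> core P e \<Longrightarrow> norm (vfield P w) \<le> B" "C-lipschitz_on (core P e) (vfield P)"
proof -
  have bl_v1: "bl (\<lambda>w. - spd w i * sin (hdg w i))" for i by (intro bl_basic)
  have bl_v2: "bl (\<lambda>w. spd w i / rad w i * cos (hdg w i))" for i by (intro bl_basic bl_divide_rad)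
  obtain B1 C1 where 1: "\<And>w. w \<in> core P e \<Longrightarrow> norm (\<chi> i. - spd w i * sin (hdg w i)) \<le> B1"
    "C1-lipschitz_on (core P e) (\<lambda>w. \<chi> i. - spd w i * sin (hdg w i))"
    using bl_vec_lambda[of "core P e" "\<lambda>w i. - spd w i * sin (hdg w i)", OF bl_v1] by blast
  obtain B2 C2 where 2: "\<And>w. w \<in> core P e \<Longrightarrow> norm (\<chi> i. spd w i / rad w i * cos (hdg w i)) \<le> B2"
    "C2-lipschitz_on (core P e) (\<lambda>w. \<chi> i. spd w i / rad w i * cos (hdg w i))"
    using bl_vec_lambda[of "core P e" "\<lambda>w i. spd w i / rad w i * cos (hdg w i)", OF bl_v2] by blast
  obtain B3 C3 where 3: "\<And>w. w \<in> core P e \<Longrightarrow> norm (\<chi> i. hdg_rate P w i) \<le> B3"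
    "C3-lipschitz_on (core P e) (\<lambda>w. \<chi> i. hdg_rate P w i)"
    using bl_vec_lambda[of "core P e" "hdg_rate P", OF bl_hdg_rate] by blast
  obtain B4 C4 where 4: "\<And>w. w \<in> core P e \<Longrightarrow> norm (\<chi> i. F P w i) \<le> B4"
    "C4-lipschitz_on (core P e) (\<lambda>w. \<chi> i. F P w i)"
    using bl_vec_lambda[of "core P e" "F P", OF bl_F] by blast
  show ?thesis
  proof (rule that)
    fix w assume w: "w \<in> core P e"
    show "norm (vfield P w) \<le> B1 + (B2 + (B3 + B4))"
      unfolding vfield_def by (intro order_trans[OF norm_Pair_le] add_mono 1 2 3 4 w)
  next
    show "(sqrt (C1\<^sup>2 + (sqrt (C2\<^sup>2 + (sqrt (C3\<^sup>2 + C4\<^sup>2))\<^sup>2))\<^sup>2))-lipschitz_on (core P e) (vfield P)"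
      unfolding vfield_def[abs_def] by (intro lipschitz_on_Pair 1 2 3 4)
  qed
qed

section \<open>Dissipation\<close>

lemma vec_has_vector_derivative:
  fixes f :: "real \<Rightarrow> real^'n"
  assumes "\<And>i. ((\<lambda>t. f t $ i) has_real_derivative d $ i) (at t within I)"
  shows "(f has_vector_derivative d) (at t within I)"
  unfolding has_vector_derivative_def
proof (subst has_derivative_componentwise_within, rule ballI)
  fix b :: "real^'n" assume "b \<in> Basis"
  then obtain i where "b = axis i 1" by (auto simp: Basis_vec_def)
  then show "((\<lambda>x. f x \<bullet> b) has_derivative (\<lambda>x. (x *\<^sub>R d) \<bullet> b)) (at t within I)"
    using assms[of i] by (simp add: inner_axis has_field_derivative_def mult_commute_abs)
qed

lemma squared_distance_has_derivative:
  fixes p :: real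
  assumes "(r1 has_real_derivative a1) (at t within I)" "(r2 has_real_derivative a2) (at t within I)"
    "(f1 has_real_derivative b1) (at t within I)" "(f2 has_real_derivative b2) (at t within I)"
  shows "((\<lambda>\<tau>. p * (r1 \<tau> - r2 \<tau>)\<^sup>2 + 2 * r1 \<tau> * r2 \<tau> * (1 - cos (f1 \<tau> - f2 \<tau>)))
    has_real_derivative 2 * (p * (r1 t - r2 t) * (a1 - a2)
      + (a1 * r2 t + r1 t * a2) * (1 - cos (f1 t - f2 t))
      + r1 t * r2 t * (sin (f1 t - f2 t) * (b1 - b2)))) (at t within I)"
proof -
  have q: "((\<lambda>\<tau>. p * (r1 \<tau> - r2 \<tau>)\<^sup>2) has_real_derivative 2 * (p * (r1 t - r2 t) * (a1 - a2))) (at t within I)"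
    by (rule derivative_eq_intros assms refl)+ simp
  have c: "((\<lambda>\<tau>. 1 - cos (f1 \<tau> - f2 \<tau>)) has_real_derivative sin (f1 t - f2 t) * (b1 - b2)) (at t within I)"
    by (rule derivative_eq_intros assms refl)+ simp
  have r: "((\<lambda>\<tau>. 2 * r1 \<tau> * r2 \<tau>) has_real_derivative 2 * (a1 * r2 t + r1 t * a2)) (at t within I)"
    by (rule derivative_eq_intros assms refl)+ simp
  show ?thesis
    by (rule DERIV_cong[OF DERIV_add[OF q DERIV_mult[OF r c]]]) (simp add: algebra_simps)
qed

lemma sqrt_has_derivative:
  assumes "(q has_real_derivative q') (at t within I)" "0 < q t"
  shows "((\<lambda>\<tau>. sqrt (q \<tau>)) has_real_derivative q' / (2 * sqrt (q t))) (at t within I)"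
  by (rule DERIV_cong[OF DERIV_chain2[OF DERIV_real_sqrt[OF assms(2)] assms(1)]]) (simp add: field_simps)

lemma vfield_components:
  "rad (vfield P w) i = - spd w i * sin (hdg w i)"
  "phi (vfield P w) i = spd w i / rad w i * cos (hdg w i)"
  "hdg (vfield P w) i = hdg_rate P w i"
  "spd (vfield P w) i = F P w i"
  unfolding rad_def phi_def hdg_def spd_def vfield_def by simp_all

lemma state_has_vector_derivative_iff:
  fixes w :: "real \<Rightarrow> 'n::finite state"
  shows "(w has_vector_derivative d) (at t within I) \<longleftrightarrow>
    (\<forall>i. ((\<lambda>\<tau>. rad (w \<tau>) i) has_real_derivative rad d i) (at t within I)
       \<and> ((\<lambda>\<tau>. phi (w \<tau>) i) has_real_derivative phi d i) (at t within I)
       \<and> ((\<lambda>\<tau>. hdg (w \<tau>) i) has_real_derivative hdg d i) (at t within I)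
       \<and> ((\<lambda>\<tau>. spd (w \<tau>) i) has_real_derivative spd d i) (at t within I))" (is "?L = ?R")
proof
  assume ?L
  have bl: "bounded_linear (\<lambda>w::'n state. rad w i)" "bounded_linear (\<lambda>w::'n state. phi w i)"
    "bounded_linear (\<lambda>w::'n state. hdg w i)" "bounded_linear (\<lambda>w::'n state. spd w i)" for i
    unfolding rad_def phi_def hdg_def spd_def
    by (intro bounded_linear_compose[OF bounded_linear_vec_nth] bounded_linear_fst
        bounded_linear_fst_comp bounded_linear_snd_comp bounded_linear_snd bounded_linear_ident)+
  show ?R
    unfolding has_real_derivative_iff_has_vector_derivative
    using bl[THEN bounded_linear.has_vector_derivative, OF \<open>?L\<close>] by blast
next
  assume ?R
  then have "((\<lambda>\<tau>. (fst (w \<tau>), fst (snd (w \<tau>)), fst (snd (snd (w \<tau>))), snd (snd (snd (w \<tau>)))))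
    has_vector_derivative (fst d, fst (snd d), fst (snd (snd d)), snd (snd (snd d)))) (at t within I)"
    unfolding rad_def phi_def hdg_def spd_def
    by (intro has_vector_derivative_Pair vec_has_vector_derivative) auto
  then show ?L by simp
qed

lemmas state_derivatives = state_has_vector_derivative_iff[THEN iffD1, rule_format]

context cruise
begin

lemma V_has_derivative:
  assumes "i \<noteq> j" "L_dist P i j < d"
  shows "(V_pot P i j has_real_derivative deriv (V_pot P i j) d) (at d)"
proof -
  have "V_pot P i j differentiable at d"
    using V_C2[OF assms(1)] assms(2) unfolding C2_differentiable_on_def
    by (auto simp: C1_differentiable_on_eq)
  then show ?thesis by (simp add: DERIV_deriv_iff_real_differentiable)
qed

lemma U_has_derivative:
  assumes "r \<in> {R_in P<..<R_out P}"
  shows "(U_pot P i has_real_derivative deriv (U_pot P i) r) (at r)"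
proof -
  have "U_pot P i differentiable at r"
    using U_C2[of i] assms unfolding C2_differentiable_on_def
    by (auto simp: C1_differentiable_on_eq)
  then show ?thesis by (simp add: DERIV_deriv_iff_real_differentiable)
qed

text \<open>The symmetry of the potentials is known only on their domain, which is open, so it passes to the
derivatives.\<close>
lemma deriv_V_sym:
  assumes "i \<noteq> j" "L_dist P i j < d"
  shows "deriv (V_pot P j i) d = deriv (V_pot P i j) d"
proof (rule DERIV_imp_deriv)
  show "(V_pot P j i has_real_derivative deriv (V_pot P i j) d) (at d)"
    by (rule DERIV_cong_ev[THEN iffD1, OF refl _ refl V_has_derivative[OF assms]])
      (use V_sym assms eventually_nhds_in_open[of "{L_dist P i j<..}" d] in \<open>auto elim!: eventually_mono\<close>)
qed

lemma dst_sym: "i \<noteq> j \<Longrightarrow> dst P w i j = dst P w j i"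
  unfolding dst_def using p_sym[of i j] cos_minus[of "phi w i - phi w j"]
  by (simp add: power2_commute[of "rad w i"] mult_ac)

end

text \<open>Each pair potential is a function of a distance that depends on the two radii and the two angles. The
coefficients of the radial and of the angular velocity of the first vehicle in its derivative are
\<open>radial_coef\<close> and \<open>angular_coef\<close>; those of the second vehicle arise by exchanging the arguments.\<close>
definition radial_coef :: "'n::finite cruise_params \<Rightarrow> 'n state \<Rightarrow> 'n \<Rightarrow> 'n \<Rightarrow> real" where
  "radial_coef P w i j = (p_coef P i j * (rad w i - rad w j) + rad w j * (1 - cos (phi w i - phi w j))) *
          (deriv (V_pot P i j) (dst P w i j) / dst P w i j)"

definition angular_coef :: "'n::finite cruise_params \<Rightarrow> 'n state \<Rightarrow> 'n \<Rightarrow> 'n \<Rightarrow> real" where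
  "angular_coef P w i j = rad w i * (deriv (V_pot P i j) (dst P w i j) *
        (rad w j * sin (phi w i - phi w j) / dst P w i j))"

context cruise
begin

lemma Phi_conv: "omega_star P * Phi P w i = (\<Sum>j\<in>UNIV - {i}. angular_coef P w i j)"
  unfolding Phi_def angular_coef_def using omega_star_pos by (simp add: sum_distrib_left)

lemma Lambda_conv: "Lambda P w i = ang_err P w i * (spd w i / (rad w i)\<^sup>2) * cos (hdg w i)
     - deriv (U_pot P i) (rad w i) - (\<Sum>j\<in>UNIV - {i}. radial_coef P w i j)"
  unfolding Lambda_def radial_coef_def ang_err_def by simp

text \<open>Action equals reaction: \<open>angular_coef\<close> is antisymmetric because the sine is odd.\<close>
lemma Phi_sum_zero:
  assumes "w \<in> Omega_ext P"
  shows "(\<Sum>i\<in>UNIV. Phi P w i) = 0"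
proof -
  have "angular_coef P w j i = - angular_coef P w i j" if "j \<in> UNIV - {i}" for i j
  proof -
    have "sin (phi w j - phi w i) = - sin (phi w i - phi w j)" using sin_minus[of "phi w i - phi w j"] by simp
    moreover have "i \<noteq> j" using that by simp
    ultimately show ?thesis
      using deriv_V_sym[of i j "dst P w i j"] Omega_ext_facts(9)[OF assms, of j i] dst_sym[of i j w]
      unfolding angular_coef_def by simp
  qed
  then have "(\<Sum>i\<in>UNIV. \<Sum>j\<in>UNIV - {i}. angular_coef P w j i) = (\<Sum>i\<in>UNIV. \<Sum>j\<in>UNIV - {i}. - angular_coef P w i j)"
    by (intro sum.cong refl)
  then have "(\<Sum>i\<in>UNIV. \<Sum>j\<in>UNIV - {i}. angular_coef P w i j) = - (\<Sum>i\<in>UNIV. \<Sum>j\<in>UNIV - {i}. angular_coef P w i j)"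
    using sum_offdiag_swap[of "angular_coef P w"] by (simp add: sum_negf)
  then have "omega_star P * (\<Sum>i\<in>UNIV. Phi P w i) = 0"
    by (simp add: sum_distrib_left Phi_conv)
  then show ?thesis using omega_star_pos by simp
qed

text \<open>Multiplied by \<open>ang_err\<close>, this is the contribution of \<open>F\<close> to the derivative of the first sum in \<open>H\<close>.
Its term \<open>- omega_star Phi\<close> cancels what the pair potentials contribute.\<close>
lemma F_conv:
  assumes "w \<in> Omega_ext P"
  shows "F P w i * cos (hdg w i) / rad w i
    = - k_gain P w i * ang_err P w i - omega_star P * (Phi P w i - G P w i)"
  unfolding F_def ang_err_def using Omega_ext_facts(12,13)[OF assms, of i]
  by (simp add: field_simps)

lemma hdg_rate_conv:
  assumes "w \<in> Omega_ext P"
  shows "a_fun P (rad w i) (hdg w i) (spd w i) * hdg_rate P w i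
    = - (mu2 P * sin (hdg w i) + (b_gain P * F P w i * sin (hdg w i) + Lambda P w i) * spd w i - M P w i)"
  unfolding hdg_rate_def using Omega_ext_facts(8)[OF assms, of i] by (simp add: field_simps)

text \<open>The left-hand side collects what one vehicle contributes to the derivative of \<open>H\<close>, its share of the pair
potentials included. The factors of the heading rate add up to \<open>a_fun\<close> times the sine of the heading,
and the terms with the radial velocity to \<open>Lambda\<close>; then \<open>hdg_rate_conv\<close> and \<open>F_conv\<close> insert the two
feedback laws. The last summand on the right is left over from splitting the angular velocity into
\<open>ang_err\<close> and \<open>omega_star\<close>, and vanishes in the sum over the vehicles.\<close>
lemma single_vehicle_balance:
  assumes D: "w \<in> Omega_ext P"
  shows "ang_err P w i * ang_err_rate P w i
      + b_gain P * (spd w i * F P w i * (sin (hdg w i))\<^sup>2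
          + (spd w i)\<^sup>2 * sin (hdg w i) * cos (hdg w i) * hdg_rate P w i)
      + deriv (U_pot P i) (rad w i) * (- spd w i * sin (hdg w i))
      + ((\<Sum>j\<in>UNIV - {i}. radial_coef P w i j) * (- spd w i * sin (hdg w i))
          + omega_star P * Phi P w i * (ang_err P w i + omega_star P))
      + A_gain P * (sin (hdg w i) * hdg_rate P w i / (cos (hdg w i) - cos (Theta P))\<^sup>2)
    = (- k_gain P w i * (ang_err P w i)\<^sup>2 + omega_star P * (ang_err P w i * G P w i)
      - mu2 P * (sin (hdg w i))\<^sup>2 + sin (hdg w i) * M P w i) + (omega_star P)\<^sup>2 * Phi P w i"
    (is "?lhs = ?rhs")
proof -
  define x s c v q S where "x = ang_err P w i" and "s = sin (hdg w i)" and "c = cos (hdg w i)" and "v = spd w i"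
    and "q = inverse (rad w i)" and "S = hdg_rate P w i"
  define E where "E = (\<Sum>j\<in>UNIV - {i}. radial_coef P w i j)"
  define U' where "U' = deriv (U_pot P i) (rad w i)"
  define C where "C = A_gain P / (c - cos (Theta P))\<^sup>2"
  define a where "a = a_fun P (rad w i) (hdg w i) (spd w i)"
  define FF where "FF = F P w i"
  define \<Lambda> where "\<Lambda> = Lambda P w i"
  have x: "x = v * q * c - omega_star P"
    by (simp add: x_def ang_err_def v_def q_def c_def divide_inverse)
  have a: "a = (b_gain P - q\<^sup>2) * v\<^sup>2 * c + omega_star P * (v * q) + C"
    by (simp add: a_def a_fun_def v_def q_def c_def C_def divide_inverse power_inverse)
  have \<Lambda>: "\<Lambda> = x * (v * q\<^sup>2) * c - U' - E"
    by (simp add: \<Lambda>_def Lambda_conv x_def v_def q_def c_def U'_def E_def divide_inverse power_inverse)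
  have rate: "ang_err_rate P w i = FF * c * q - v * s * S * q + v\<^sup>2 * s * c * q\<^sup>2"
    by (simp add: ang_err_rate_def FF_def v_def q_def c_def s_def S_def divide_inverse power_inverse)
  \<comment> \<open>With \<open>q\<close> for the inverse radius, what remains are polynomial identities.\<close>
  have "?lhs = x * (FF * c * q - v * s * S * q + v\<^sup>2 * s * c * q\<^sup>2)
      + b_gain P * (v * FF * s\<^sup>2 + v\<^sup>2 * s * c * S) + U' * (- v * s)
      + (E * (- v * s) + omega_star P * Phi P w i * (x + omega_star P)) + C * (s * S)"
    unfolding rate[symmetric] by (simp add: x_def s_def c_def v_def S_def E_def U'_def C_def FF_def)
  also have "\<dots> = x * (FF * c * q + omega_star P * Phi P w i) + (omega_star P)\<^sup>2 * Phi P w i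
      + s * (a * S + v * (b_gain P * FF * s + \<Lambda>))"
    unfolding a \<Lambda> unfolding x by algebra
  also have "a * S = - (mu2 P * s + (b_gain P * FF * s + \<Lambda>) * v - M P w i)"
    unfolding a_def S_def s_def FF_def \<Lambda>_def v_def by (rule hdg_rate_conv[OF D])
  also have "FF * c * q = - k_gain P w i * x - omega_star P * (Phi P w i - G P w i)"
    using F_conv[OF D, of i] by (simp add: FF_def c_def q_def x_def divide_inverse)
  also have "x * (- k_gain P w i * x - omega_star P * (Phi P w i - G P w i) + omega_star P * Phi P w i)
      + (omega_star P)\<^sup>2 * Phi P w i
      + s * (- (mu2 P * s + (b_gain P * FF * s + \<Lambda>) * v - M P w i) + v * (b_gain P * FF * s + \<Lambda>))
      = (- k_gain P w i * x\<^sup>2 + omega_star P * (x * G P w i) - mu2 P * s\<^sup>2 + s * M P w i)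
      + (omega_star P)\<^sup>2 * Phi P w i"
    by algebra
  finally show ?thesis by (simp add: x_def s_def)
qed

end

text \<open>The part of the derivative of a pair potential that is due to the motion of the first vehicle.\<close>
definition interaction_rate :: "'n::finite cruise_params \<Rightarrow> 'n state \<Rightarrow> 'n \<Rightarrow> 'n \<Rightarrow> real" where
  "interaction_rate P w i j = radial_coef P w i j * (- spd w i * sin (hdg w i))
      + angular_coef P w i j * (spd w i / rad w i * cos (hdg w i))"

lemma (in cruise) V_dst_has_derivative:
  assumes der: "(w has_vector_derivative vfield P (w t)) (at t within I)" and D: "w t \<in> Omega_ext P"
    and ij: "i \<noteq> j"
  shows "((\<lambda>\<tau>. V_pot P i j (dst P (w \<tau>) i j)) has_real_derivative
    interaction_rate P (w t) i j + interaction_rate P (w t) j i) (at t within I)"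
proof -
  define W where "W = w t"
  have D: "W \<in> Omega_ext P" using D by (simp add: W_def)
  note facts = Omega_ext_facts[OF D]
  have dr: "((\<lambda>\<tau>. rad (w \<tau>) i) has_real_derivative - spd W i * sin (hdg W i)) (at t within I)"
    and dphi: "((\<lambda>\<tau>. phi (w \<tau>) i) has_real_derivative spd W i / rad W i * cos (hdg W i)) (at t within I)" for i
    using state_derivatives[OF der, of i] unfolding vfield_components W_def[symmetric] by auto
  define rate where "rate = interaction_rate P W"
  let ?q = "\<lambda>u. p_coef P i j * (rad u i - rad u j)\<^sup>2 + 2 * rad u i * rad u j * (1 - cos (phi u i - phi u j))"
  let ?q' = "2 * (p_coef P i j * (rad W i - rad W j) * (- spd W i * sin (hdg W i) - (- spd W j * sin (hdg W j)))
    + ((- spd W i * sin (hdg W i)) * rad W j + rad W i * (- spd W j * sin (hdg W j))) * (1 - cos (phi W i - phi W j))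
    + rad W i * rad W j * (sin (phi W i - phi W j) *
        (spd W i / rad W i * cos (hdg W i) - spd W j / rad W j * cos (hdg W j))))"
  have q: "((\<lambda>\<tau>. ?q (w \<tau>)) has_real_derivative ?q') (at t within I)"
    unfolding W_def by (rule squared_distance_has_derivative[OF dr[of i] dr[of j] dphi[of i] dphi[of j], unfolded W_def])
  have "0 < dst P W i j" using facts(10)[of j i] ij by simp
  then have qpos: "0 < ?q (w t)" by (simp only: dst_def real_sqrt_gt_0_iff W_def)
  have dd: "((\<lambda>\<tau>. dst P (w \<tau>) i j) has_real_derivative ?q' / (2 * dst P W i j)) (at t within I)"
    using sqrt_has_derivative[OF q qpos] unfolding dst_def W_def .
  have "((\<lambda>\<tau>. V_pot P i j (dst P (w \<tau>) i j)) has_real_derivative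
      deriv (V_pot P i j) (dst P W i j) * (?q' / (2 * dst P W i j))) (at t within I)"
    by (rule DERIV_chain2[OF _ dd])
      (use V_has_derivative[OF ij, of "dst P W i j"] facts(9)[of j i] ij in \<open>simp add: W_def\<close>)
  moreover have "deriv (V_pot P i j) (dst P W i j) * (?q' / (2 * dst P W i j)) = rate i j + rate j i"
  proof -
    have sym: "dst P W j i = dst P W i j" "p_coef P j i = p_coef P i j"
      "deriv (V_pot P j i) (dst P W i j) = deriv (V_pot P i j) (dst P W i j)"
      using dst_sym[of i j W] p_sym[of i j] deriv_V_sym[of i j "dst P W i j"] facts(9)[of j i] ij by simp_all
    have trig: "sin (phi W j - phi W i) = - sin (phi W i - phi W j)" "cos (phi W j - phi W i) = cos (phi W i - phi W j)"
      using sin_minus[of "phi W i - phi W j"] cos_minus[of "phi W i - phi W j"] by simp_all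
    define E where "E = deriv (V_pot P i j) (dst P W i j) / dst P W i j"
    define si ci where "si = sin (phi W i - phi W j)" and "ci = cos (phi W i - phi W j)"
    define ri rj where "ri = - spd W i * sin (hdg W i)" and "rj = - spd W j * sin (hdg W j)"
    define ai aj where "ai = spd W i / rad W i * cos (hdg W i)" and "aj = spd W j / rad W j * cos (hdg W j)"
    define R R' where "R = rad W i" and "R' = rad W j"
    have cancel: "u * (2 * x / (2 * d)) = u / d * x" for u x d :: real by simp
    have "rate i j = (p_coef P i j * (R - R') + R' * (1 - ci)) * E * ri + R * (R' * si) * E * ai"
      by (simp add: rate_def interaction_rate_def radial_coef_def angular_coef_def E_def si_def ci_def ri_def ai_def R_def R'_def)
    moreover have "rate j i = (p_coef P i j * (R' - R) + R * (1 - ci)) * E * rj - R' * (R * si) * E * aj"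
      by (simp add: rate_def interaction_rate_def radial_coef_def angular_coef_def E_def si_def ci_def rj_def aj_def R_def R'_def sym trig)
    moreover have "deriv (V_pot P i j) (dst P W i j) * (?q' / (2 * dst P W i j))
      = E * (p_coef P i j * (R - R') * (ri - rj) + (ri * R' + R * rj) * (1 - ci) + R * R' * (si * (ai - aj)))"
      unfolding E_def si_def ci_def ri_def rj_def ai_def aj_def R_def R'_def by (rule cancel)
    ultimately show ?thesis by algebra
  qed
  ultimately show ?thesis by (simp add: rate_def W_def)
qed

context cruise
begin

lemma ang_err_has_derivative:
  assumes der: "(w has_vector_derivative vfield P (w t)) (at t within I)" and D: "w t \<in> Omega_ext P"
  shows "((\<lambda>\<tau>. ang_err P (w \<tau>) i) has_real_derivative ang_err_rate P (w t) i) (at t within I)"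
proof -
  have dr: "((\<lambda>\<tau>. rad (w \<tau>) i) has_real_derivative - spd (w t) i * sin (hdg (w t) i)) (at t within I)"
    and ds: "((\<lambda>\<tau>. hdg (w \<tau>) i) has_real_derivative hdg_rate P (w t) i) (at t within I)"
    and dv: "((\<lambda>\<tau>. spd (w \<tau>) i) has_real_derivative F P (w t) i) (at t within I)"
    using state_derivatives[OF der, of i] unfolding vfield_components by auto
  show ?thesis
    unfolding ang_err_def
    by (rule derivative_eq_intros dr ds dv refl Omega_ext_facts(13)[OF D])+
      (use Omega_ext_facts(13)[OF D, of i] in \<open>simp add: ang_err_rate_def field_simps power2_eq_square\<close>)
qed

text \<open>In the double sum over pairs every \<open>interaction_rate\<close> occurs twice. This absorbs the factor one half and
leaves to each vehicle the part due to its own motion, so that the balance of a single vehicle applies.\<close>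
lemma H_has_derivative:
  assumes der: "(w has_vector_derivative vfield P (w t)) (at t within I)" and D: "w t \<in> Omega_ext P"
  shows "((\<lambda>\<tau>. H P (w \<tau>)) has_real_derivative H_rate P (w t)) (at t within I)"
proof -
  define W where "W = w t"
  have D: "W \<in> Omega_ext P" using D by (simp add: W_def)
  note facts = Omega_ext_facts[OF D]
  have dr: "((\<lambda>\<tau>. rad (w \<tau>) i) has_real_derivative - spd W i * sin (hdg W i)) (at t within I)"
    and dphi: "((\<lambda>\<tau>. phi (w \<tau>) i) has_real_derivative spd W i / rad W i * cos (hdg W i)) (at t within I)"
    and ds: "((\<lambda>\<tau>. hdg (w \<tau>) i) has_real_derivative hdg_rate P W i) (at t within I)"
    and dv: "((\<lambda>\<tau>. spd (w \<tau>) i) has_real_derivative F P W i) (at t within I)" for i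
    using state_derivatives[OF der, of i] unfolding vfield_components W_def[symmetric] by auto
  have d1: "((\<lambda>\<tau>. (spd (w \<tau>) i / rad (w \<tau>) i * cos (hdg (w \<tau>) i) - omega_star P)\<^sup>2)
      has_real_derivative 2 * (ang_err P W i * ang_err_rate P W i)) (at t within I)" for i
    unfolding ang_err_def[of P "w _", symmetric] W_def
    by (rule DERIV_cong[OF DERIV_power[OF ang_err_has_derivative[OF der D[unfolded W_def]]]]) simp
  have d2: "((\<lambda>\<tau>. (spd (w \<tau>) i)\<^sup>2 * (sin (hdg (w \<tau>) i))\<^sup>2) has_real_derivative
      2 * (spd W i * F P W i * (sin (hdg W i))\<^sup>2
          + (spd W i)\<^sup>2 * sin (hdg W i) * cos (hdg W i) * hdg_rate P W i)) (at t within I)" for i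
    by (rule derivative_eq_intros ds dv refl)+
      (simp add: W_def[symmetric] algebra_simps)
  have d3: "((\<lambda>\<tau>. U_pot P i (rad (w \<tau>) i)) has_real_derivative
      deriv (U_pot P i) (rad W i) * (- spd W i * sin (hdg W i))) (at t within I)" for i
    by (rule DERIV_chain2[OF _ dr]) (use U_has_derivative[of "rad W i" i] facts(1,2)[of i] in \<open>simp add: W_def\<close>)
  define rate where "rate i j = radial_coef P W i j * (- spd W i * sin (hdg W i))
      + angular_coef P W i j * (spd W i / rad W i * cos (hdg W i))" for i j
  have d4: "((\<lambda>\<tau>. V_pot P i j (dst P (w \<tau>) i j)) has_real_derivative rate i j + rate j i) (at t within I)"
    if "i \<noteq> j" for i j
    using V_dst_has_derivative[OF der D[unfolded W_def] that] unfolding rate_def W_def interaction_rate_def .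
  have d5: "((\<lambda>\<tau>. 1 / (cos (hdg (w \<tau>) i) - cos (Theta P)) - 1 / (1 - cos (Theta P))) has_real_derivative
      sin (hdg W i) * hdg_rate P W i / (cos (hdg W i) - cos (Theta P))\<^sup>2) (at t within I)" for i
    by (rule derivative_eq_intros ds refl facts(14)[unfolded W_def])+
      (use facts(14)[of i] in \<open>simp_all add: W_def[symmetric] power2_eq_square\<close>)
  have "((\<lambda>\<tau>. H P (w \<tau>)) has_real_derivative
      1/2 * (\<Sum>i\<in>UNIV. 2 * (ang_err P W i * ang_err_rate P W i))
     + b_gain P / 2 * (\<Sum>i\<in>UNIV. 2 * (spd W i * F P W i * (sin (hdg W i))\<^sup>2
          + (spd W i)\<^sup>2 * sin (hdg W i) * cos (hdg W i) * hdg_rate P W i))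
     + (\<Sum>i\<in>UNIV. deriv (U_pot P i) (rad W i) * (- spd W i * sin (hdg W i)))
     + 1/2 * (\<Sum>i\<in>UNIV. \<Sum>j\<in>UNIV - {i}. rate i j + rate j i)
     + A_gain P * (\<Sum>i\<in>UNIV. sin (hdg W i) * hdg_rate P W i / (cos (hdg W i) - cos (Theta P))\<^sup>2)) (at t within I)"
    unfolding H_def by (intro DERIV_add DERIV_cmult DERIV_sum d1 d2 d3 d4 d5) auto
  moreover have "(\<Sum>j\<in>UNIV - {i}. rate i j) = (\<Sum>j\<in>UNIV - {i}. radial_coef P W i j) * (- spd W i * sin (hdg W i))
          + omega_star P * Phi P W i * (ang_err P W i + omega_star P)" for i
    unfolding rate_def sum.distrib Phi_conv ang_err_def sum_distrib_right[symmetric] by simp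
  then have "1/2 * (\<Sum>i\<in>UNIV. \<Sum>j\<in>UNIV - {i}. rate i j + rate j i)
    = (\<Sum>i\<in>UNIV. (\<Sum>j\<in>UNIV - {i}. radial_coef P W i j) * (- spd W i * sin (hdg W i))
          + omega_star P * Phi P W i * (ang_err P W i + omega_star P))"
    unfolding sum_offdiag_symmetrize by simp
  moreover have "H_rate P W = H_rate P W + (omega_star P)\<^sup>2 * (\<Sum>i\<in>UNIV. Phi P W i)"
    using Phi_sum_zero[OF D] by simp
  then have "H_rate P W = (\<Sum>i\<in>UNIV. ang_err P W i * ang_err_rate P W i)
     + b_gain P * (\<Sum>i\<in>UNIV. spd W i * F P W i * (sin (hdg W i))\<^sup>2
          + (spd W i)\<^sup>2 * sin (hdg W i) * cos (hdg W i) * hdg_rate P W i)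
     + (\<Sum>i\<in>UNIV. deriv (U_pot P i) (rad W i) * (- spd W i * sin (hdg W i)))
     + (\<Sum>i\<in>UNIV. (\<Sum>j\<in>UNIV - {i}. radial_coef P W i j) * (- spd W i * sin (hdg W i))
          + omega_star P * Phi P W i * (ang_err P W i + omega_star P))
     + A_gain P * (\<Sum>i\<in>UNIV. sin (hdg W i) * hdg_rate P W i / (cos (hdg W i) - cos (Theta P))\<^sup>2)"
    unfolding H_rate_def sum_distrib_left sum.distrib[symmetric] single_vehicle_balance[OF D, symmetric] .
  ultimately show ?thesis unfolding W_def[symmetric] sum_distrib_left[symmetric] by (simp add: sum_distrib_left[symmetric])
qed

text \<open>If \<open>y = Phi - G\<close> is negative, the argument of \<open>f_gain\<close> is \<open>- c y\<close> with \<open>c \<ge> 1\<close>, and \<open>f_gain\<close> restores at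
least \<open>- y\<close>.\<close>
lemma k_gain_ge:
  assumes D: "w \<in> Omega_ext P" shows "mu1 P \<le> k_gain P w i"
proof -
  define y where "y = Phi P w i - G P w i"
  define c where "c = v_max P * cos (hdg w i) / (v_max P * cos (hdg w i) - rad w i * omega_star P)"
  have c: "1 \<le> c" unfolding c_def using Omega_ext_facts(3,11)[OF D, of i] omega_star_pos by simp
  have "0 \<le> y + max 0 (- c * y)"
  proof (cases "0 \<le> y")
    case False
    then have "c * y \<le> 1 * y" using c by (intro mult_right_mono_neg) auto
    then show ?thesis by simp
  qed simp
  also have "\<dots> \<le> y + f_gain P (- c * y)" using f_ge by (intro add_left_mono) blast
  finally show ?thesis by (simp add: k_gain_def y_def c_def)
qed

lemma H_rate_le:
  assumes D: "w \<in> Omega_ext P"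
  shows "H_rate P w \<le> - (\<Sum>i\<in>UNIV. mu1 P * (ang_err P w i)\<^sup>2 + mu2 P * (sin (hdg w i))\<^sup>2)"
proof -
  define q where "q i j = kappa P i j (dst P w i j)" for i j
  have q: "0 \<le> q i j" "q i j = q j i" if "i \<noteq> j" for i j
    unfolding q_def using kappa_nonneg kappa_sym dst_sym[OF that] Omega_ext_facts(9)[OF D] that by metis+
  have "omega_star P * (ang_err P w i * G P w i)
      = (spd w i / rad w i * cos (hdg w i) - omega_star P) * (\<Sum>j\<in>UNIV - {i}. q i j *
        (g1 P (spd w j / rad w j * cos (hdg w j)) - g1 P (spd w i / rad w i * cos (hdg w i))))" for i
    using omega_star_pos by (simp add: ang_err_def G_def q_def)
  then have "(\<Sum>i\<in>UNIV. omega_star P * (ang_err P w i * G P w i)) \<le> 0"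
    using sum_consensus_nonpos[OF q g1_mono, where y = "\<lambda>i. spd w i / rad w i * cos (hdg w i)" and c = "omega_star P"] by simp
  moreover have "(\<Sum>i\<in>UNIV. sin (hdg w i) * M P w i) \<le> 0"
    using sum_consensus_nonpos[OF q g2_mono, where y = "\<lambda>i. sin (hdg w i)" and c = 0] by (simp add: M_def q_def)
  moreover have "(\<Sum>i\<in>UNIV. mu1 P * (ang_err P w i)\<^sup>2) \<le> (\<Sum>i\<in>UNIV. k_gain P w i * (ang_err P w i)\<^sup>2)"
    by (intro sum_mono mult_right_mono k_gain_ge D) auto
  ultimately show ?thesis
    unfolding H_rate_def by (simp add: sum.distrib sum_subtractf sum_negf)
qed

lemma H_rate_nonpos: "w \<in> Omega_ext P \<Longrightarrow> H_rate P w \<le> 0"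
  by (rule order_trans[OF H_rate_le]) (auto intro!: sum_nonneg simp: mu1_pos mu2_pos less_imp_le)

section \<open>Confinement to the core\<close>

lemma F_pos_if_at_rest:
  assumes D: "w \<in> Omega_ext P" and "spd w i = 0" shows "0 < F P w i"
proof -
  define \<rho> where "\<rho> = rad w i * omega_star P / cos (hdg w i)"
  have \<rho>: "0 < \<rho>" unfolding \<rho>_def using Omega_ext_facts(3,5)[OF D, of i] omega_star_pos by simp
  define u where "u = - (v_max P * cos (hdg w i) / (v_max P * cos (hdg w i) - rad w i * omega_star P))
                  * (Phi P w i - G P w i)"
  have "F P w i = \<rho> * (mu1 P + f_gain P u)"
    unfolding F_def k_gain_def \<rho>_def[symmetric] u_def[symmetric] assms(2) by (simp add: algebra_simps)
  moreover have "0 \<le> f_gain P u" using f_ge[of u] by simp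
  ultimately show ?thesis using \<rho> mu1_pos by simp
qed

text \<open>The factor in front of \<open>Phi - G\<close> in the argument of \<open>f_gain\<close> is made for this estimate. With
\<open>\<rho> = r omega_star / cos s < v_max\<close> and \<open>y = Phi - G\<close>, that argument is \<open>- v_max y / (v_max - \<rho>)\<close>, and
\<open>f_gain u \<ge> u\<close> gives \<open>(v_max - \<rho>) f_gain u \<ge> - v_max y\<close>. So \<open>F\<close> is at most \<open>- mu1 (v_max - \<rho>)\<close>.\<close>
lemma F_neg_if_at_max:
  assumes D: "w \<in> Omega_ext P" and v: "spd w i = v_max P" shows "F P w i < 0"
proof -
  define \<rho> where "\<rho> = rad w i * omega_star P / cos (hdg w i)"
  have c: "0 < cos (hdg w i)" using Omega_ext_facts(5)[OF D] .
  have \<rho>: "0 < v_max P - \<rho>" unfolding \<rho>_def using Omega_ext_facts(11)[OF D, of i] c by (simp add: field_simps)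
  define y where "y = Phi P w i - G P w i"
  have "v_max P * cos (hdg w i) / (v_max P * cos (hdg w i) - rad w i * omega_star P) = v_max P / (v_max P - \<rho>)"
    using Omega_ext_facts(11)[OF D, of i] c \<rho> by (simp add: \<rho>_def field_simps)
  then have F: "F P w i = - (mu1 P * (v_max P - \<rho>)) - (v_max P * y + f_gain P (- (v_max P / (v_max P - \<rho>)) * y) * (v_max P - \<rho>))"
    unfolding F_def k_gain_def v \<rho>_def[symmetric] y_def[symmetric] add_diff_eq[symmetric] by (simp add: algebra_simps)
  have "- (v_max P / (v_max P - \<rho>)) * y * (v_max P - \<rho>) \<le> f_gain P (- (v_max P / (v_max P - \<rho>)) * y) * (v_max P - \<rho>)"
    using f_ge[of "- (v_max P / (v_max P - \<rho>)) * y"] \<rho> by (intro mult_right_mono) auto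
  also have "- (v_max P / (v_max P - \<rho>)) * y * (v_max P - \<rho>) = - (v_max P * y)" using \<rho> by simp
  finally have "F P w i \<le> - (mu1 P * (v_max P - \<rho>))" unfolding F by linarith
  also have "\<dots> < 0" using mu1_pos \<rho> by simp
  finally show ?thesis .
qed

lemma H_decreasing:
  assumes "a \<le> b" and w: "\<And>t. t \<in> {a..b} \<Longrightarrow> (w has_vector_derivative vfield P (w t)) (at t within {a..b})"
    and D: "\<And>t. t \<in> {a..b} \<Longrightarrow> w t \<in> Omega_ext P"
  shows "H P (w b) \<le> H P (w a)"
  by (rule nonincreasing_if_derivative_nonpos[OF assms(1) H_has_derivative[OF w D] H_rate_nonpos[OF D]])

end

text \<open>A barrier in the form needed for coercivity: below a given level, a margin can be kept from the singularity.\<close>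
lemma at_top_at_right_bound:
  fixes f :: "real \<Rightarrow> real"
  assumes "filterlim f at_top (at_right a)"
  shows "eventually (\<lambda>e. \<forall>x. a < x \<and> x \<le> a + e \<longrightarrow> c < f x) (at_right 0)"
proof -
  have "eventually (\<lambda>x. c < f x) (at_right a)" using assms by (auto simp: filterlim_at_top_dense)
  then obtain b where "a < b" "\<forall>x>a. x < b \<longrightarrow> c < f x" unfolding eventually_at_right_field by blast
  then show ?thesis unfolding eventually_at_right_field by (intro exI[of _ "b - a"]) auto
qed

lemma at_top_at_left_bound:
  fixes f :: "real \<Rightarrow> real"
  assumes "filterlim f at_top (at_left a)"
  shows "eventually (\<lambda>e. \<forall>x. x < a \<and> a - e \<le> x \<longrightarrow> c < f x) (at_right 0)"
proof -
  have "eventually (\<lambda>x. c < f x) (at_left a)" using assms by (auto simp: filterlim_at_top_dense)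
  then obtain b where "b < a" "\<forall>x>b. x < a \<longrightarrow> c < f x" unfolding eventually_at_left_field by blast
  then show ?thesis unfolding eventually_at_right_field by (intro exI[of _ "a - b"]) auto
qed

context cruise
begin

text \<open>All summands of \<open>H\<close> are nonnegative, so each one is bounded by the total. Pair potentials carry the
factor one half, hence the factor 2.\<close>
lemma H_bounds_parts:
  assumes w: "w \<in> Omega P"
  shows "0 \<le> H P w" "U_pot P i (rad w i) \<le> H P w"
    "i \<noteq> j \<Longrightarrow> V_pot P i j (dst P w i j) \<le> 2 * H P w"
    "A_gain P * (1 / (cos (hdg w i) - cos (Theta P)) - 1 / (1 - cos (Theta P))) \<le> H P w"
proof -
  note facts = Omega_ext_facts[OF subsetD[OF Omega_subset_Omega_ext w]]
  define T1 where "T1 = 1/2 * (\<Sum>i\<in>UNIV. (spd w i / rad w i * cos (hdg w i) - omega_star P)\<^sup>2)"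
  define T2 where "T2 = b_gain P / 2 * (\<Sum>i\<in>UNIV. (spd w i)\<^sup>2 * (sin (hdg w i))\<^sup>2)"
  define T3 where "T3 = (\<Sum>i\<in>UNIV. U_pot P i (rad w i))"
  define T4 where "T4 = (\<Sum>i\<in>UNIV. \<Sum>j\<in>UNIV - {i}. V_pot P i j (dst P w i j))"
  define B where "B i = A_gain P * (1 / (cos (hdg w i) - cos (Theta P)) - 1 / (1 - cos (Theta P)))" for i
  have H: "H P w = T1 + T2 + T3 + 1/2 * T4 + sum B UNIV"
    unfolding H_def T1_def T2_def T3_def T4_def B_def sum_distrib_left by simp
  have "0 \<le> T1" "0 \<le> T2"
    unfolding T1_def T2_def using b_gain_pos by (simp_all add: sum_nonneg)
  have U: "0 \<le> U_pot P i (rad w i)" for i using U_nonneg facts(1,2) by blast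
  have V: "0 \<le> V_pot P i j (dst P w i j)" if "j \<in> UNIV - {i}" for i j
    using V_nonneg[of i j] facts(9)[of j i] that by simp
  have B: "0 \<le> B i" for i
    unfolding B_def using A_pos facts(4)[of i] by (intro mult_nonneg_nonneg) (auto simp: frac_le)
  have "0 \<le> T3" "0 \<le> T4" "0 \<le> sum B UNIV"
    unfolding T3_def T4_def using U V B by (auto intro!: sum_nonneg)
  note nonneg = \<open>0 \<le> T1\<close> \<open>0 \<le> T2\<close> this
  show "0 \<le> H P w" using nonneg H by linarith
  have "U_pot P i (rad w i) \<le> T3" unfolding T3_def by (rule member_le_sum) (use U in auto)
  then show "U_pot P i (rad w i) \<le> H P w" using nonneg H by linarith
  have "B i \<le> sum B UNIV" by (rule member_le_sum) (use B in auto)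
  then show "A_gain P * (1 / (cos (hdg w i) - cos (Theta P)) - 1 / (1 - cos (Theta P))) \<le> H P w"
    using nonneg H unfolding B_def[of i, symmetric] by linarith
  assume "i \<noteq> j"
  then have "V_pot P i j (dst P w i j) \<le> (\<Sum>j\<in>UNIV - {i}. V_pot P i j (dst P w i j))"
    by (intro member_le_sum[of j _ "\<lambda>j. V_pot P i j (dst P w i j)"]) (use V in auto)
  also have "\<dots> \<le> T4" unfolding T4_def
    by (rule member_le_sum[of i _ "\<lambda>i. \<Sum>j\<in>UNIV - {i}. V_pot P i j (dst P w i j)"]) (auto intro!: sum_nonneg V)
  finally show "V_pot P i j (dst P w i j) \<le> 2 * H P w" using nonneg H by linarith
qed

text \<open>Radii, headings and distances cannot come close to the boundary of their ranges because a summand of \<open>H\<close>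
blows up there; finitely many constraints admit a common margin.\<close>
lemma sublevel_subset_inner_core:
  obtains e where "0 < e" "\<And>w. w \<in> Omega P \<Longrightarrow> H P w \<le> h \<Longrightarrow> w \<in> inner_core P e"
proof -
  have "filterlim (\<lambda>x. A_gain P * (- (1 / (1 - cos (Theta P))) + inverse x)) at_top (at_right 0)"
    by (rule filterlim_tendsto_pos_mult_at_top[OF tendsto_const A_pos
        filterlim_tendsto_add_at_top[OF tendsto_const filterlim_inverse_at_top_right]])
  note cos_bound = at_top_at_right_bound[OF this, of h]
  have V_bound: "eventually (\<lambda>e. \<forall>j. i \<noteq> j \<longrightarrow> (\<forall>x. L_dist P i j < x \<and> x \<le> L_dist P i j + e \<longrightarrow> 2 * h < V_pot P i j x)) (at_right 0)" for i
  proof (rule eventually_all_finite)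
    fix j show "eventually (\<lambda>e. i \<noteq> j \<longrightarrow> (\<forall>x. L_dist P i j < x \<and> x \<le> L_dist P i j + e \<longrightarrow> 2 * h < V_pot P i j x)) (at_right 0)"
      using at_top_at_right_bound[OF V_lim, of i j "2 * h"] by (cases "i = j") auto
  qed
  have "eventually (\<lambda>e. 0 < e
    \<and> (\<forall>i x. R_in P < x \<and> x \<le> R_in P + e \<longrightarrow> h < U_pot P i x)
    \<and> (\<forall>i x. x < R_out P \<and> R_out P - e \<le> x \<longrightarrow> h < U_pot P i x)
    \<and> (\<forall>x. 0 < x \<and> x \<le> 0 + e \<longrightarrow> h < A_gain P * (- (1 / (1 - cos (Theta P))) + inverse x))
    \<and> (\<forall>i j. i \<noteq> j \<longrightarrow> (\<forall>x. L_dist P i j < x \<and> x \<le> L_dist P i j + e \<longrightarrow> 2 * h < V_pot P i j x))) (at_right 0)"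
    by (intro eventually_conj eventually_all_finite[OF V_bound] cos_bound
        eventually_all_finite[OF at_top_at_right_bound[OF U_lim_in]]
        eventually_all_finite[OF at_top_at_left_bound[OF U_lim_out]] eventually_at_right_less)
  then obtain e where e: "0 < e"
    and U1: "\<And>i x. R_in P < x \<Longrightarrow> x \<le> R_in P + e \<Longrightarrow> h < U_pot P i x"
    and U2: "\<And>i x. x < R_out P \<Longrightarrow> R_out P - e \<le> x \<Longrightarrow> h < U_pot P i x"
    and c: "\<And>x. 0 < x \<Longrightarrow> x \<le> 0 + e \<Longrightarrow> h < A_gain P * (- (1 / (1 - cos (Theta P))) + inverse x)"
    and V: "\<And>i j x. i \<noteq> j \<Longrightarrow> L_dist P i j < x \<Longrightarrow> x \<le> L_dist P i j + e \<Longrightarrow> 2 * h < V_pot P i j x"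
    by (auto dest!: eventually_happens'[rotated])
  show ?thesis
  proof (rule that[OF e])
    fix w assume w: "w \<in> Omega P" and h: "H P w \<le> h"
    note facts = Omega_ext_facts[OF subsetD[OF Omega_subset_Omega_ext w]] and parts = H_bounds_parts[OF w]
    have "R_in P + e < rad w i" for i
      using U1[of "rad w i" i] facts(1)[of i] parts(2)[of i] h by linarith
    moreover have "rad w i < R_out P - e" for i
      using U2[of "rad w i" i] facts(2)[of i] parts(2)[of i] h by linarith
    moreover have "cos (Theta P) + e < cos (hdg w i)" for i
    proof -
      have "A_gain P * (- (1 / (1 - cos (Theta P))) + inverse (cos (hdg w i) - cos (Theta P))) \<le> h"
        using parts(4)[of i] h by (simp add: inverse_eq_divide)
      then show ?thesis using c[of "cos (hdg w i) - cos (Theta P)"] facts(4)[of i] by linarith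
    qed
    moreover have "L_dist P i j + e < dst P w i j" if "j \<noteq> i" for i j
      using V[OF not_sym[OF that] facts(9)[OF that]] parts(3)[OF not_sym[OF that]] h by linarith
    moreover have "\<bar>hdg w i\<bar> < Theta P" "spd w i \<in> {0<..<v_max P}" for i
      using w unfolding Omega_def by (simp_all add: abs_less_iff) (metis minus_less_iff)
    ultimately show "w \<in> inner_core P e" unfolding inner_core_def by simp
  qed
qed

end

lemma continuous_on_coordinates:
  "continuous_on S (\<lambda>w::'n::finite state. rad w i)" "continuous_on S (\<lambda>w::'n state. hdg w i)"
  "continuous_on S (\<lambda>w::'n state. spd w i)" "continuous_on S (\<lambda>w::'n state. phi w i)"
  by (rule lipschitz_on_continuous_on, rule lipschitz_coordinates)+

lemma continuous_on_dst: "continuous_on S (\<lambda>w::'n::finite state. dst P w i j)"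
  unfolding dst_def by (intro continuous_intros continuous_on_coordinates)

lemma open_Collect_all_finite:
  assumes "\<And>i::'i::finite. open {x. Q i x}" shows "open {x. \<forall>i. Q i x}"
proof -
  have "{x. \<forall>i. Q i x} = (\<Inter>i. {x. Q i x})" by auto
  then show ?thesis by (simp only:) (intro open_INT finite ballI assms)
qed

lemma open_inner_core: "open (inner_core P e)"
  unfolding inner_core_def greaterThanLessThan_iff
  by (intro open_Collect_conj open_Collect_all_finite open_Collect_imp open_Collect_less
      closed_Collect_const continuous_intros continuous_on_coordinates continuous_on_dst)

lemma closed_core: "closed (core P e)"
  unfolding core_def atLeastAtMost_iff
  by (intro closed_Collect_conj closed_Collect_all closed_Collect_imp closed_Collect_le
      open_Collect_const continuous_intros continuous_on_coordinates continuous_on_dst)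

context cruise
begin

text \<open>On \<open>Omega P\<close> speeds are positive, so the division by the speed in \<open>delta\<close> is undone by the factor \<open>spd\<close> in
the heading equation.\<close>
lemma closed_loop_solution_iff:
  "closed_loop_solution P w0 I w \<longleftrightarrow> is_interval I \<and> 0 \<in> I \<and> w 0 = w0 \<and>
     (\<forall>t\<in>I. w t \<in> Omega P \<and> (w has_vector_derivative vfield P (w t)) (at t within I))"
proof -
  have rate: "spd u i / sigma P i * tan (delta P u i) - spd u i / rad u i * cos (hdg u i) = hdg_rate P u i"
    if u: "u \<in> Omega P" for u i
  proof -
    have "spd u i \<noteq> 0" "sigma P i \<noteq> 0"
      using u sigma_pos[of i] unfolding Omega_def by (auto simp: less_imp_neq[THEN not_sym])
    moreover have "rad u i \<noteq> 0" "a_fun P (rad u i) (hdg u i) (spd u i) \<noteq> 0"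
      using Omega_ext_facts(8,13)[OF subsetD[OF Omega_subset_Omega_ext u], of i] by auto
    ultimately show ?thesis
      unfolding delta_def tan_arctan hdg_rate_def by (simp add: field_simps)
  qed
  show ?thesis
    unfolding closed_loop_solution_def state_has_vector_derivative_iff vfield_components
    by (simp only: rate cong: conj_cong)
qed

text \<open>A speed that reached 0 or \<open>v_max\<close> for the first time at \<open>T\<close> would have a derivative of the wrong sign
there. So \<open>w T\<close> still lies in \<open>Omega P\<close>, where \<open>H\<close> has not increased, and the sublevel set lies in
\<open>inner_core P e\<close>.\<close>
lemma no_exit_from_inner_core:
  assumes w: "\<And>t. t \<in> {0..T} \<Longrightarrow> (w has_vector_derivative vfield P (w t)) (at t within {0..T})"
    and T: "0 < T" and before: "\<And>t. 0 \<le> t \<Longrightarrow> t < T \<Longrightarrow> w t \<in> inner_core P e"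
    and e: "0 < e" and last: "w T \<in> core P e"
    and sublevel: "\<And>u. u \<in> Omega P \<Longrightarrow> H P u \<le> H P (w 0) \<Longrightarrow> u \<in> inner_core P e"
  shows "w T \<in> inner_core P e"
proof -
  have core: "w t \<in> core P e" if "t \<in> {0..T}" for t
    using that before[of t] last inner_core_subset_core by (cases "t = T") auto
  have ext: "w t \<in> Omega_ext P" if "t \<in> {0..T}" for t
    using core[OF that] core_subset_Omega_ext[OF e] by blast
  have spd_before: "0 < spd (w (T - h)) i" "spd (w (T - h)) i < v_max P" if "0 < h" "h < T" for h i
    using before[of "T - h"] that unfolding inner_core_def by auto
  have dv: "((\<lambda>\<tau>. spd (w \<tau>) i) has_real_derivative F P (w T) i) (at T within {0..T})" for i
    using state_derivatives[OF w[of T], of i] T unfolding vfield_components by simp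
  have "spd (w T) i \<noteq> 0" for i
  proof
    assume 0: "spd (w T) i = 0"
    have "0 < F P (w T) i" using F_pos_if_at_rest[OF ext 0] T by simp
    from has_real_derivative_pos_inc_left[OF dv this]
    obtain d where d: "d > 0" "\<forall>h>0. T - h \<in> {0..T} \<longrightarrow> h < d \<longrightarrow> spd (w (T - h)) i < spd (w T) i" by blast
    define h where "h = min d T / 2"
    have h: "0 < h" "h < T" "h < d" using d T by (auto simp: h_def)
    then show False using d(2)[rule_format, of h] spd_before(1)[OF h(1,2), of i] 0 by auto
  qed
  moreover have "spd (w T) i \<noteq> v_max P" for i
  proof
    assume m: "spd (w T) i = v_max P"
    have "F P (w T) i < 0" using F_neg_if_at_max[OF ext m] T by simp
    from has_real_derivative_neg_dec_left[OF dv this]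
    obtain d where d: "d > 0" "\<forall>h>0. T - h \<in> {0..T} \<longrightarrow> h < d \<longrightarrow> spd (w T) i < spd (w (T - h)) i" by blast
    define h where "h = min d T / 2"
    have h: "0 < h" "h < T" "h < d" using d T by (auto simp: h_def)
    then show False using d(2)[rule_format, of h] spd_before(2)[OF h(1,2), of i] m by auto
  qed
  moreover have extT: "w T \<in> Omega_ext P" using ext T by simp
  ultimately have "spd (w T) i \<in> {0<..<v_max P}" for i
    using Omega_ext_facts(6,7)[OF extT, of i] by (simp add: less_le)
  then have "w T \<in> Omega P"
    using extT unfolding Omega_ext_def Omega_def by (simp add: abs_less_iff) (metis minus_less_iff)
  moreover have "H P (w T) \<le> H P (w 0)"
    by (rule H_decreasing[OF _ w ext]) (use T in auto)
  ultimately show ?thesis by (rule sublevel)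
qed

text \<open>The competitors \<open>z\<close> are treated like \<open>w\<close>: they stay in \<open>Omega P\<close> by definition, so the decrease of \<open>H\<close>
keeps them in the core, where the extended vector field is the original one.\<close>
lemma global_solution:
  assumes w0: "w0 \<in> Omega P"
  obtains w e where "closed_loop_solution P w0 {0..} w" "0 < e" "\<And>t. 0 \<le> t \<Longrightarrow> w t \<in> core P e"
    "\<And>I z t. I \<subseteq> {0..} \<Longrightarrow> closed_loop_solution P w0 I z \<Longrightarrow> t \<in> I \<Longrightarrow> z t = w t"
proof -
  obtain e where e: "0 < e" and sublevel: "\<And>u. u \<in> Omega P \<Longrightarrow> H P u \<le> H P w0 \<Longrightarrow> u \<in> inner_core P e"
    using sublevel_subset_inner_core[of "H P w0"] by blast
  interpret cruise_core P e by unfold_locales (rule e)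
  obtain C where C: "C-lipschitz_on (core P e) (vfield P)" using vfield_bounded_lipschitz by blast
  obtain g M where g: "M-lipschitz_on UNIV g" "\<And>u. u \<in> core P e \<Longrightarrow> g u = vfield P u"
    using lipschitz_extension[OF C] by blast
  obtain w where w: "w 0 = w0" "\<And>t. t \<ge> 0 \<Longrightarrow> (w has_vector_derivative g (w t)) (at t within {0..})"
    using lipschitz_ode_exists[OF g(1), of w0] by blast
  have w_cont: "continuous_on {0..} w"
    using w(2) by (auto simp: continuous_on_eq_continuous_within intro: has_vector_derivative_continuous)
  have inner: "w t \<in> inner_core P e" if "0 \<le> t" for t
  proof (rule ccontr)
    assume "w t \<notin> inner_core P e"
    define E where "E = {0..} \<inter> w -` (- inner_core P e)"
    \<comment> \<open>The first exit time; it belongs to \<open>E\<close>, as \<open>inner_core P e\<close> is open.\<close>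
    define T where "T = Inf E"
    have "closed E"
      unfolding E_def by (intro continuous_closed_preimage w_cont) (auto simp: open_inner_core closed_def)
    moreover have "E \<noteq> {}" using \<open>w t \<notin> inner_core P e\<close> that by (auto simp: E_def)
    moreover have bdd: "bdd_below E" by (auto simp: E_def)
    ultimately have "T \<in> E" unfolding T_def by (intro closed_contains_Inf)
    then have TE: "0 \<le> T" "w T \<notin> inner_core P e" by (auto simp: E_def)
    have "T \<noteq> 0" using TE(2) sublevel[OF w0] w(1) by auto
    then have T: "0 < T" using TE by simp
    have before: "w s \<in> inner_core P e" if "0 \<le> s" "s < T" for s
    proof (rule ccontr)
      assume "w s \<notin> inner_core P e"
      then have "s \<in> E" using that by (simp add: E_def)
      then show False using cInf_lower[OF _ bdd] that unfolding T_def by fastforce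
    qed
    have "w s \<in> core P e" if "s \<in> {0..<T}" for s
      using before[of s] that inner_core_subset_core by auto
    moreover have "continuous_on (closure {0..<T}) w"
      by (rule continuous_on_subset[OF w_cont]) (use T in auto)
    ultimately have "w ` closure {0..<T} \<subseteq> core P e"
      by (intro image_closure_subset closed_core image_subsetI)
    then have core: "w s \<in> core P e" if "s \<in> {0..T}" for s using that T by auto
    have "w T \<in> inner_core P e"
    proof (rule no_exit_from_inner_core[OF _ T before e])
      fix s assume s: "s \<in> {0..T}"
      then have "(w has_vector_derivative g (w s)) (at s within {0..T})"
        by (intro has_vector_derivative_within_subset[OF w(2)]) auto
      then show "(w has_vector_derivative vfield P (w s)) (at s within {0..T})"
        using g(2)[OF core[OF s]] by simp
    qed (use core T sublevel w(1) in auto)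
    then show False using TE by blast
  qed
  have core: "w t \<in> core P e" if "0 \<le> t" for t using inner[OF that] inner_core_subset_core by blast
  show ?thesis
  proof (rule that[OF _ e core])
    show "closed_loop_solution P w0 {0..} w"
      unfolding closed_loop_solution_iff
      using w g(2)[OF core] inner inner_core_subset_Omega[OF e] by (auto simp: is_interval_ci)
    fix I z t
    assume I: "I \<subseteq> {0..}" and z: "closed_loop_solution P w0 I z" and t: "t \<in> I"
    have z': "is_interval I" "0 \<in> I" "z 0 = w0"
      "\<And>s. s \<in> I \<Longrightarrow> z s \<in> Omega P" "\<And>s. s \<in> I \<Longrightarrow> (z has_vector_derivative vfield P (z s)) (at s within I)"
      using z unfolding closed_loop_solution_iff by auto
    have sub: "{0..s} \<subseteq> I" if "s \<in> I" for s
      using z'(1,2) that unfolding is_interval_1 by fastforce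
    have z_within: "(z has_vector_derivative vfield P (z s)) (at s within {0..u})" if "u \<in> I" "s \<in> {0..u}" for s u
      by (rule has_vector_derivative_within_subset[OF z'(5) sub[OF that(1)]]) (use sub[OF that(1)] that in blast)
    have z_core: "z s \<in> core P e" if s: "s \<in> I" for s
    proof -
      have "H P (z s) \<le> H P (z 0)"
      proof (rule H_decreasing[OF _ z_within[OF s]])
        fix u assume "u \<in> {0..s}"
        then show "z u \<in> Omega_ext P" using sub[OF s] z'(4) Omega_subset_Omega_ext by blast
      qed (use I s in auto)
      then show ?thesis using sublevel[OF z'(4)[OF s]] z'(3) inner_core_subset_core by auto
    qed
    show "z t = w t"
    proof (rule lipschitz_ode_unique[OF g(1)])
      show "0 \<le> t" using t I by auto
      fix s assume s: "s \<in> {0..t}"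
      then have "s \<in> I" using sub[OF t] by blast
      then show "(z has_vector_derivative g (z s)) (at s within {0..t})"
        using z_within[OF t s] g(2)[OF z_core] by simp
      show "(w has_vector_derivative g (w s)) (at s within {0..t})"
        by (rule has_vector_derivative_within_subset[OF w(2)]) (use s in auto)
    qed (use z' w in simp)
  qed
qed

end

section \<open>Convergence and bounds\<close>

lemma tendsto_at_top_if_nonincreasing:
  fixes f :: "real \<Rightarrow> real"
  assumes mono: "\<And>s t. 0 \<le> s \<Longrightarrow> s \<le> t \<Longrightarrow> f t \<le> f s" and bound: "\<And>t. 0 \<le> t \<Longrightarrow> c \<le> f t"
  obtains l where "(f \<longlongrightarrow> l) at_top"
proof
  have bdd: "bdd_below (f ` {0..})" using bound by (auto intro!: bdd_belowI2)
  show "(f \<longlongrightarrow> Inf (f ` {0..})) at_top"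
  proof (rule order_tendstoI)
    fix a assume "a < Inf (f ` {0..})"
    then have "a < f t" if "0 \<le> t" for t using cInf_lower[OF _ bdd, of "f t"] that by fastforce
    then show "eventually (\<lambda>t. a < f t) at_top" by (rule eventually_mono[OF eventually_ge_at_top[of 0]])
  next
    fix a assume "Inf (f ` {0..}) < a"
    then obtain s where s: "0 \<le> s" "f s < a" using cInf_lessD[of "f ` {0..}" a] by auto
    show "eventually (\<lambda>t. f t < a) at_top"
      by (rule eventually_mono[OF eventually_ge_at_top[of s] le_less_trans[OF mono[OF s(1)] s(2)]])
  qed
qed

lemma tendsto_zero_if_sin_tendsto_zero:
  fixes s :: "'a \<Rightarrow> real"
  assumes "((\<lambda>t. sin (s t)) \<longlongrightarrow> 0) net" and "eventually (\<lambda>t. \<bar>s t\<bar> \<le> pi / 2) net"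
  shows "(s \<longlongrightarrow> 0) net"
proof -
  have "((\<lambda>t. arcsin (sin (s t))) \<longlongrightarrow> arcsin 0) net"
    by (rule isCont_tendsto_compose[OF _ assms(1)]) (simp add: isCont_arcsin)
  then have "((\<lambda>t. arcsin (sin (s t))) \<longlongrightarrow> 0) net" by simp
  then show ?thesis
  proof (rule Lim_transform_eventually)
    show "eventually (\<lambda>t. arcsin (sin (s t)) = s t) net"
      using assms(2) by eventually_elim (intro arcsin_sin, linarith+)
  qed
qed

context cruise_core
begin

text \<open>A bounded Lipschitz function of the state is Lipschitz in time along the trajectory, which is what
Barbalat's lemma needs; this is used for \<open>H_rate\<close>, \<open>hdg_rate\<close> and \<open>ang_err_rate\<close>.\<close>
lemma core_solution_tendsto:
  assumes w: "\<And>t. 0 \<le> t \<Longrightarrow> (w has_vector_derivative vfield P (w t)) (at t within {0..})"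
    and core: "\<And>t. 0 \<le> t \<Longrightarrow> w t \<in> core P e" and Om: "\<And>t. 0 \<le> t \<Longrightarrow> w t \<in> Omega P"
  shows "((\<lambda>t. hdg (w t) i) \<longlongrightarrow> 0) at_top"
    "((\<lambda>t. spd (w t) i / rad (w t) i) \<longlongrightarrow> omega_star P) at_top"
    "((\<lambda>t. hdg_rate P (w t) i) \<longlongrightarrow> 0) at_top"
    "((\<lambda>t. F P (w t) i) \<longlongrightarrow> 0) at_top"
proof -
  obtain B where BC: "\<And>u. u \<in> core P e \<Longrightarrow> norm (vfield P u) \<le> B"
    using vfield_bounded_lipschitz by blast
  have B: "0 \<le> B" using order_trans[OF norm_ge_zero BC[OF core]] by blast
  have w_lip: "B-lipschitz_on {0..} w"
  proof (rule bounded_derivative_imp_lipschitz)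
    fix t :: real assume "t \<in> {0..}"
    then show "(w has_derivative (\<lambda>x. x *\<^sub>R vfield P (w t))) (at t within {0..})"
      using w unfolding has_vector_derivative_def by simp
    show "onorm (\<lambda>x. x *\<^sub>R vfield P (w t)) \<le> B"
    proof (rule onorm_le)
      fix x :: real
      show "norm (x *\<^sub>R vfield P (w t)) \<le> B * norm x"
        using BC[OF core] \<open>t \<in> {0..}\<close> by (simp add: mult.commute[of B] mult_left_mono)
    qed
  qed (use B in auto)
  have lip: "\<exists>C. C-lipschitz_on {0..} (\<lambda>t. \<psi> (w t))" if \<psi>: "bl \<psi>" for \<psi>
  proof -
    obtain C where C: "C-lipschitz_on (core P e) \<psi>" using \<psi> by (auto simp: bl_on_def)
    have "w ` {0..} \<subseteq> core P e" using core by auto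
    then have "(C * B)-lipschitz_on {0..} (\<lambda>t. \<psi> (w t))"
      by (intro lipschitz_on_compose2[OF w_lip lipschitz_on_subset[OF C]])
    then show ?thesis by blast
  qed
  have ext: "w t \<in> Omega_ext P" if "0 \<le> t" for t using in_ext core that by blast
  have pos: "eventually (\<lambda>t::real. 0 \<le> t) at_top" by (rule eventually_ge_at_top)

  have H_der: "((\<lambda>t. H P (w t)) has_real_derivative H_rate P (w t)) (at t within {0..})" if "0 \<le> t" for t
    by (rule H_has_derivative[OF w ext]) (use that in auto)
  have H_mono: "H P (w t) \<le> H P (w s)" if "0 \<le> s" "s \<le> t" for s t
    by (rule H_decreasing[OF that(2)])
      (use that ext w in \<open>auto intro: has_vector_derivative_within_subset[OF w]\<close>)
  obtain l where l: "((\<lambda>t. H P (w t)) \<longlongrightarrow> l) at_top"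
    by (rule tendsto_at_top_if_nonincreasing[OF H_mono H_bounds_parts(1)[OF Om]])
  have H_rate0: "((\<lambda>t. H_rate P (w t)) \<longlongrightarrow> 0) at_top"
    using lip[OF bl_H_rate] Barbalat[OF l H_der] by blast
  have part: "(y \<longlongrightarrow> 0) at_top"
    if "0 < m" and y: "\<And>t. 0 \<le> t \<Longrightarrow> m * (y t)\<^sup>2 \<le> - H_rate P (w t)" for y :: "real \<Rightarrow> real" and m
  proof -
    have "((\<lambda>t. m * (y t)\<^sup>2) \<longlongrightarrow> 0) at_top"
    proof (rule tendsto_sandwich[OF _ _ tendsto_const])
      show "((\<lambda>t. - H_rate P (w t)) \<longlongrightarrow> 0) at_top" using tendsto_minus[OF H_rate0] by simp
    qed (use eventually_mono[OF pos y] \<open>0 < m\<close> in auto)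
    from tendsto_mult[OF tendsto_const[of "1 / m"] this] have "((\<lambda>t. (y t)\<^sup>2) \<longlongrightarrow> 0) at_top"
      using \<open>0 < m\<close> by simp
    then have "((\<lambda>t. sqrt ((y t)\<^sup>2)) \<longlongrightarrow> 0) at_top" using tendsto_real_sqrt by fastforce
    then show ?thesis by (simp add: tendsto_rabs_zero_iff)
  qed
  have diss: "mu1 P * (ang_err P (w t) i)\<^sup>2 + mu2 P * (sin (hdg (w t) i))\<^sup>2 \<le> - H_rate P (w t)" if "0 \<le> t" for t i
  proof -
    have "mu1 P * (ang_err P (w t) i)\<^sup>2 + mu2 P * (sin (hdg (w t) i))\<^sup>2
      \<le> (\<Sum>i\<in>UNIV. mu1 P * (ang_err P (w t) i)\<^sup>2 + mu2 P * (sin (hdg (w t) i))\<^sup>2)"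
      by (rule member_le_sum[of i UNIV "\<lambda>i. mu1 P * (ang_err P (w t) i)\<^sup>2 + mu2 P * (sin (hdg (w t) i))\<^sup>2"])
        (use mu1_pos mu2_pos in auto)
    then show ?thesis using H_rate_le[OF ext[OF that]] by linarith
  qed
  have err0: "((\<lambda>t. ang_err P (w t) i) \<longlongrightarrow> 0) at_top"
  proof (rule part[OF mu1_pos])
    fix t :: real assume "0 \<le> t"
    have "0 \<le> mu2 P * (sin (hdg (w t) i))\<^sup>2" using mu2_pos by simp
    then show "mu1 P * (ang_err P (w t) i)\<^sup>2 \<le> - H_rate P (w t)" using diss[OF \<open>0 \<le> t\<close>, of i] by linarith
  qed
  have sin0: "((\<lambda>t. sin (hdg (w t) i)) \<longlongrightarrow> 0) at_top"
  proof (rule part[OF mu2_pos])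
    fix t :: real assume "0 \<le> t"
    have "0 \<le> mu1 P * (ang_err P (w t) i)\<^sup>2" using mu1_pos by simp
    then show "mu2 P * (sin (hdg (w t) i))\<^sup>2 \<le> - H_rate P (w t)" using diss[OF \<open>0 \<le> t\<close>, of i] by linarith
  qed
  have "\<bar>hdg (w t) i\<bar> \<le> pi / 2" if "0 \<le> t" for t
    using core_facts(3)[OF core[OF that], of i] Theta_less by linarith
  then show hdg0: "((\<lambda>t. hdg (w t) i) \<longlongrightarrow> 0) at_top"
    by (intro tendsto_zero_if_sin_tendsto_zero[OF sin0] eventually_mono[OF pos])
  have cos1: "((\<lambda>t. cos (hdg (w t) i)) \<longlongrightarrow> 1) at_top"
    using tendsto_cos[OF hdg0] by simp
  have "((\<lambda>t. (ang_err P (w t) i + omega_star P) / cos (hdg (w t) i)) \<longlongrightarrow> (0 + omega_star P) / 1) at_top"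
    by (intro tendsto_intros err0 cos1) simp
  then have "((\<lambda>t. (ang_err P (w t) i + omega_star P) / cos (hdg (w t) i)) \<longlongrightarrow> omega_star P) at_top"
    by simp
  moreover have "(ang_err P (w t) i + omega_star P) / cos (hdg (w t) i) = spd (w t) i / rad (w t) i" if "0 \<le> t" for t
    using Omega_ext_facts(12)[OF ext[OF that], of i] by (simp add: ang_err_def)
  ultimately show ratio: "((\<lambda>t. spd (w t) i / rad (w t) i) \<longlongrightarrow> omega_star P) at_top"
    by (rule Lim_transform_eventually[OF _ eventually_mono[OF pos]])
  have der: "((\<lambda>t. rad (w t) i) has_real_derivative - spd (w t) i * sin (hdg (w t) i)) (at t within {0..})"
    "((\<lambda>t. hdg (w t) i) has_real_derivative hdg_rate P (w t) i) (at t within {0..})"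
    "((\<lambda>t. spd (w t) i) has_real_derivative F P (w t) i) (at t within {0..})" if "0 \<le> t" for t
    using state_derivatives[OF w[OF that], of i] unfolding vfield_components by auto
  show rate0: "((\<lambda>t. hdg_rate P (w t) i) \<longlongrightarrow> 0) at_top"
    using lip[OF bl_hdg_rate[of i]] Barbalat[OF hdg0 der(2)] by blast
  have err_der: "((\<lambda>t. ang_err P (w t) i) has_real_derivative ang_err_rate P (w t) i) (at t within {0..})" if "0 \<le> t" for t
    by (rule ang_err_has_derivative[OF w ext]) (use that in auto)
  have err_rate0: "((\<lambda>t. ang_err_rate P (w t) i) \<longlongrightarrow> 0) at_top"
    using lip[OF bl_ang_err_rate[of i]] Barbalat[OF err0 err_der] by blast
  \<comment> \<open>Convergence of the speeds is not known, so Barbalat's lemma does not apply to \<open>spd\<close> and its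
  derivative \<open>F\<close>. Instead \<open>ang_err_rate\<close> is solved for \<open>F / rad\<close>.\<close>
  define K where "K u = spd u i / rad u i" for u :: "'n state"
  have K: "((\<lambda>t. K (w t)) \<longlongrightarrow> omega_star P) at_top" using ratio by (simp add: K_def)
  have "((\<lambda>t. (ang_err_rate P (w t) i + K (w t) * sin (hdg (w t) i) * hdg_rate P (w t) i
      - (K (w t))\<^sup>2 * sin (hdg (w t) i) * cos (hdg (w t) i)) / cos (hdg (w t) i)) \<longlongrightarrow>
      (0 + omega_star P * 0 * 0 - (omega_star P)\<^sup>2 * 0 * 1) / 1) at_top"
    by (intro tendsto_intros err_rate0 K sin0 rate0 cos1) simp
  then have "((\<lambda>t. (ang_err_rate P (w t) i + K (w t) * sin (hdg (w t) i) * hdg_rate P (w t) i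
      - (K (w t))\<^sup>2 * sin (hdg (w t) i) * cos (hdg (w t) i)) / cos (hdg (w t) i)) \<longlongrightarrow> 0) at_top"
    by simp
  then have F_rad: "((\<lambda>t. F P (w t) i / rad (w t) i) \<longlongrightarrow> 0) at_top"
  proof (rule Lim_transform_eventually)
    show "eventually (\<lambda>t. (ang_err_rate P (w t) i + K (w t) * sin (hdg (w t) i) * hdg_rate P (w t) i
      - (K (w t))\<^sup>2 * sin (hdg (w t) i) * cos (hdg (w t) i)) / cos (hdg (w t) i) = F P (w t) i / rad (w t) i) at_top"
      using pos
    proof eventually_elim
      case (elim t)
      then show ?case using Omega_ext_facts(12,13)[OF ext, of t i]
        by (simp add: ang_err_rate_def K_def power_divide) 
    qed
  qed
  show "((\<lambda>t. F P (w t) i) \<longlongrightarrow> 0) at_top"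
  proof (rule Lim_null_comparison)
    show "((\<lambda>t. R_out P * \<bar>F P (w t) i / rad (w t) i\<bar>) \<longlongrightarrow> 0) at_top"
      using tendsto_mult[OF tendsto_const[of "R_out P"] tendsto_rabs[OF F_rad]] by simp
    show "eventually (\<lambda>t. norm (F P (w t) i) \<le> R_out P * \<bar>F P (w t) i / rad (w t) i\<bar>) at_top"
      using pos
    proof eventually_elim
      case (elim t)
      have r: "0 < rad (w t) i" "rad (w t) i < R_out P" using Omega_ext_facts(2,3)[OF ext[OF elim], of i] by auto
      have "\<bar>F P (w t) i\<bar> = rad (w t) i * \<bar>F P (w t) i / rad (w t) i\<bar>" using r by (simp add: abs_divide)
      also have "\<dots> \<le> R_out P * \<bar>F P (w t) i / rad (w t) i\<bar>" using r by (intro mult_right_mono) auto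
      finally show ?case by simp
    qed
  qed
qed

end

context cruise
begin

text \<open>The supremum of the accelerations over a sublevel set is monotone in the level by construction. The
inserted 0 makes the set nonempty when the sublevel set is empty.\<close>
definition F_bound :: "real \<Rightarrow> real" where
  "F_bound h = Sup (insert 0 {\<bar>F P w i\<bar> | w i. w \<in> Omega P \<and> H P w \<le> h})"

lemma bdd_above_F: "bdd_above (insert 0 {\<bar>F P w i\<bar> | w i. w \<in> Omega P \<and> H P w \<le> h})"
proof -
  obtain e where e: "0 < e" and sublevel: "\<And>u. u \<in> Omega P \<Longrightarrow> H P u \<le> h \<Longrightarrow> u \<in> inner_core P e"
    using sublevel_subset_inner_core[of h] by blast
  interpret cruise_core P e by unfold_locales (rule e)
  have "\<forall>i. \<exists>B. \<forall>w\<in>core P e. \<bar>F P w i\<bar> \<le> B" using bl_F unfolding bl_on_def by blast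
  then obtain B where B: "\<And>i w. w \<in> core P e \<Longrightarrow> \<bar>F P w i\<bar> \<le> B i" by metis
  have "\<bar>F P w i\<bar> \<le> (\<Sum>i\<in>UNIV. \<bar>B i\<bar>)" if "w \<in> Omega P" "H P w \<le> h" for w i
  proof -
    have "\<bar>F P w i\<bar> \<le> \<bar>B i\<bar>"
      using B[of w i] sublevel[OF that] inner_core_subset_core by fastforce
    also have "\<dots> \<le> (\<Sum>i\<in>UNIV. \<bar>B i\<bar>)" by (rule member_le_sum) auto
    finally show ?thesis .
  qed
  then show ?thesis by (intro bdd_aboveI[of _ "\<Sum>i\<in>UNIV. \<bar>B i\<bar>"]) (auto intro: sum_nonneg)
qed

lemma F_bound_mono: "h \<le> h' \<Longrightarrow> F_bound h \<le> F_bound h'"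
  unfolding F_bound_def by (intro cSup_subset_mono bdd_above_F) (blast intro: order_trans)+

lemma F_bound_nonneg: "0 \<le> F_bound h"
  unfolding F_bound_def by (intro cSup_upper bdd_above_F) simp

lemma F_le_F_bound: "w \<in> Omega P \<Longrightarrow> H P w \<le> h \<Longrightarrow> \<bar>F P w i\<bar> \<le> F_bound h"
  unfolding F_bound_def by (intro cSup_upper bdd_above_F) blast

end

theorem theorem1:
  fixes P :: "'n::finite cruise_params"
  assumes "cruise P"
  shows "(\<forall>w0 \<in> Omega P. \<exists>w.
            closed_loop_solution P w0 {0..} w
          \<and> (\<forall>I z. I \<subseteq> {0..} \<and> closed_loop_solution P w0 I z \<longrightarrow> (\<forall>t\<in>I. z t = w t))
          \<and> (\<forall>t\<ge>0. w t \<in> Omega P)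
          \<and> (\<forall>i. ((\<lambda>t. hdg (w t) i) \<longlongrightarrow> 0) at_top
                \<and> ((\<lambda>t. spd (w t) i / rad (w t) i) \<longlongrightarrow> omega_star P) at_top
                \<and> ((\<lambda>t. deriv (\<lambda>\<tau>. hdg (w \<tau>) i) t) \<longlongrightarrow> 0) at_top
                \<and> ((\<lambda>t. F P (w t) i) \<longlongrightarrow> 0) at_top))
       \<and> (\<exists>P1 :: real \<Rightarrow> real. mono_on {0..} P1 \<and> P1 \<in> {0..} \<rightarrow> {0..} \<and>
            (\<forall>w0 \<in> Omega P. \<forall>w. closed_loop_solution P w0 {0..} w \<longrightarrow>
               (\<forall>t\<ge>0. \<forall>i. \<bar>F P (w t) i\<bar> + \<bar>delta P (w t) i\<bar> \<le> P1 (H P w0))))"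
proof (intro conjI ballI)
  interpret cruise P by (rule assms)
  fix w0 assume "w0 \<in> Omega P"
  then obtain w e where sol: "closed_loop_solution P w0 {0..} w" and e: "0 < e"
    and core: "\<And>t. 0 \<le> t \<Longrightarrow> w t \<in> core P e"
    and unique: "\<And>I z t. I \<subseteq> {0..} \<Longrightarrow> closed_loop_solution P w0 I z \<Longrightarrow> t \<in> I \<Longrightarrow> z t = w t"
    using global_solution by metis
  interpret cruise_core P e by unfold_locales (rule e)
  have Om: "w t \<in> Omega P" and w: "(w has_vector_derivative vfield P (w t)) (at t within {0..})" if "0 \<le> t" for t
    using sol that unfolding closed_loop_solution_iff by auto
  note limits = core_solution_tendsto[OF w core Om]
  have "((\<lambda>t. deriv (\<lambda>\<tau>. hdg (w \<tau>) i) t) \<longlongrightarrow> 0) at_top" for i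
  proof (rule Lim_transform_eventually[OF limits(3)[of i]])
    show "eventually (\<lambda>t. hdg_rate P (w t) i = deriv (\<lambda>\<tau>. hdg (w \<tau>) i) t) at_top"
      using eventually_gt_at_top[of 0]
    proof eventually_elim
      case (elim t)
      have "((\<lambda>\<tau>. hdg (w \<tau>) i) has_real_derivative hdg_rate P (w t) i) (at t within {0..})"
        using state_derivatives[OF w[OF less_imp_le[OF elim]], of i] unfolding vfield_components by blast
      then have "((\<lambda>\<tau>. hdg (w \<tau>) i) has_real_derivative hdg_rate P (w t) i) (at t)"
        using at_within_interior[of t "{0..}"] elim by simp
      then show ?case by (rule DERIV_imp_deriv[symmetric])
    qed
  qed
  then show "\<exists>w. closed_loop_solution P w0 {0..} w
          \<and> (\<forall>I z. I \<subseteq> {0..} \<and> closed_loop_solution P w0 I z \<longrightarrow> (\<forall>t\<in>I. z t = w t))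
          \<and> (\<forall>t\<ge>0. w t \<in> Omega P)
          \<and> (\<forall>i. ((\<lambda>t. hdg (w t) i) \<longlongrightarrow> 0) at_top
                \<and> ((\<lambda>t. spd (w t) i / rad (w t) i) \<longlongrightarrow> omega_star P) at_top
                \<and> ((\<lambda>t. deriv (\<lambda>\<tau>. hdg (w \<tau>) i) t) \<longlongrightarrow> 0) at_top
                \<and> ((\<lambda>t. F P (w t) i) \<longlongrightarrow> 0) at_top)"
    using sol unique Om limits(1,2,4) by blast
next
  interpret cruise P by (rule assms)
  have "\<bar>F P (w t) i\<bar> + \<bar>delta P (w t) i\<bar> \<le> F_bound (H P w0) + pi / 2"
    if sol: "closed_loop_solution P w0 {0..} w" and t: "0 \<le> t" for w0 w t i
  proof -
    have w: "w 0 = w0" "\<And>t. 0 \<le> t \<Longrightarrow> w t \<in> Omega P"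
      "\<And>t. 0 \<le> t \<Longrightarrow> (w has_vector_derivative vfield P (w t)) (at t within {0..})"
      using sol unfolding closed_loop_solution_iff by auto
    have "H P (w t) \<le> H P (w 0)"
      by (rule H_decreasing[OF t])
        (use w(2) Omega_subset_Omega_ext in \<open>auto intro: has_vector_derivative_within_subset[OF w(3)]\<close>)
    then have "\<bar>F P (w t) i\<bar> \<le> F_bound (H P w0)" using F_le_F_bound[OF w(2)[OF t]] w(1) by simp
    moreover have "\<bar>delta P (w t) i\<bar> \<le> pi / 2"
    proof -
      have "\<bar>arctan y\<bar> \<le> pi / 2" for y using arctan_bounded[of y] by linarith
      then show ?thesis unfolding delta_def .
    qed
    ultimately show ?thesis by linarith
  qed
  moreover have "mono_on {0..} (\<lambda>h. F_bound h + pi / 2)"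
    by (auto intro!: mono_onI F_bound_mono)
  moreover have "(\<lambda>h. F_bound h + pi / 2) \<in> {0..} \<rightarrow> {0..}"
    using F_bound_nonneg by (auto intro!: add_nonneg_nonneg)
  ultimately show "\<exists>P1 :: real \<Rightarrow> real. mono_on {0..} P1 \<and> P1 \<in> {0..} \<rightarrow> {0..} \<and>
            (\<forall>w0 \<in> Omega P. \<forall>w. closed_loop_solution P w0 {0..} w \<longrightarrow>
               (\<forall>t\<ge>0. \<forall>i. \<bar>F P (w t) i\<bar> + \<bar>delta P (w t) i\<bar> \<le> P1 (H P w0)))"
    by (intro exI[of _ "\<lambda>h. F_bound h + pi / 2"]) blast
qed

end
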